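(* Let $\Sigma_M$, $\dot q(t)=V_{u}(q(t))$, $u\in U$, be a control dynamical system on a compact connected manifold $M^n$ such that at every point $q\in M^n$ the set of control vectors $V(q)$ is ample and the Lie algebra rank condition (LARC) is satisfied. Then $\Sigma_M$ is controllable on $M^n$ if and only if for an arbitrary point $q\in M^n$ there exists a non-trivial closed trajectory of $\Sigma_M$ going through $q$ (i.e. a trajectory $q(t)$, $0\le t\le t_q$, with $t_q>0$ and $q(0)=q(t_q)=q$).
   Context: $M^n$ is an $n$-dimensional manifold without boundary. The control system $\Sigma_M$ is given by smooth vector fields $V_u$ on $M^n$ depending on a control parameter $u\in U$ (usually $U$ is a domain in $\mathbb{R}^d$); each $V_u$ generates a one-parameter group of diffeomorphisms $P_u^t$. A trajectory of $\Sigma_M$ is a curve $q(t)$ with $\dot q(t)=V_{u(t)}(q(t))$ for some admissible (usually locally integrable) control function $u(t)\in U$; it is assumed that control functions and trajectories can be approximated by piecewise constant controls and the corresponding trajectories. The system is controllable on $M^n$ if for every two points $p,p'\in M^n$ there is a trajectory of $\Sigma_M$ starting at $p$ and ending at $p'$. LARC at $q$: the Lie algebra generated by some finite number of the control vector fields $V_{u_i}$, evaluated at $q$, is the whole tangent space $T_qM^n$. For a point $q$ put $V(q)=\{V_u(q): u\in U\}\subset T_qM^n$, and let $L(q)$ be the linear subspace of $T_qM^n$ spanned by $V(q)$. It is assumed that $\dim L(q)$ is locally constant and that the spaces $L(q')$, for $q'$ in a small neighborhood $B(q)$ of $q$, form a smooth locally trivial vector bundle $L_B=\bigcup_{q'\in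 B(q)}L(q')$ (a subbundle of $TM|_{B(q)}$). The set of control vectors is open at $q$ if $\bigcup_{q'\in B(q)}V(q')$ is an open subset of $L_B$. $V(q)$ is ample if it is open at $q$ in this sense and the convex hull of $V(q)$ equals $L(q)$. *)

theory Defs
  imports "HOL-Analysis.Analysis" "HOL-Library.Function_Algebras"
begin

section \<open>Pointwise real vector space structure on functions\<close>

instantiation "fun" :: (type, real_vector) real_vector
begin

definition scaleR_fun :: "real \<Rightarrow> ('a \<Rightarrow> 'b) \<Rightarrow> 'a \<Rightarrow> 'b"
  where "scaleR_fun r f = (\<lambda>x. r *\<^sub>R f x)"

instance
  by standard (auto simp: scaleR_fun_def fun_eq_iff scaleR_add_right scaleR_add_left)

end


section \<open>Smooth maps and smooth manifolds\<close>

text \<open>Meant for open sets \<open>S\<close>: all iterated directional derivatives up to order \<open>k\<close> exist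
  and are continuous on \<open>S\<close>.\<close>

fun Ck_on :: "nat \<Rightarrow> 'a::real_normed_vector set \<Rightarrow> ('a \<Rightarrow> 'b::real_normed_vector) \<Rightarrow> bool" where
  "Ck_on 0 S f \<longleftrightarrow> continuous_on S f"
| "Ck_on (Suc k) S f \<longleftrightarrow>
     (\<forall>x\<in>S. f differentiable (at x)) \<and> (\<forall>v. Ck_on k S (\<lambda>x. frechet_derivative f (at x) v))"

definition smooth_on :: "'a::real_normed_vector set \<Rightarrow> ('a \<Rightarrow> 'b::real_normed_vector) \<Rightarrow> bool"
  where "smooth_on S f \<longleftrightarrow> (\<forall>k. Ck_on k S f)"

text \<open>A chart is a pair of an open domain and a coordinate map; only the values of the map on
  the domain matter. The dimension of the manifold is \<open>DIM('e)\<close>.\<close>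

type_synonym ('a, 'e) chart = "'a set \<times> ('a \<Rightarrow> 'e)"

definition chart_inv :: "('a, 'e) chart \<Rightarrow> 'e \<Rightarrow> 'a"
  where "chart_inv c = inv_into (fst c) (snd c)"

definition chart_img :: "('a, 'e) chart \<Rightarrow> 'e set"
  where "chart_img c = snd c ` fst c"

definition is_chart :: "('a::topological_space, 'e::euclidean_space) chart \<Rightarrow> bool"
  where "is_chart c \<longleftrightarrow> open (fst c) \<and> open (chart_img c) \<and>
           homeomorphism (fst c) (chart_img c) (snd c) (chart_inv c)"

definition transition :: "('a, 'e) chart \<Rightarrow> ('a, 'e) chart \<Rightarrow> 'e \<Rightarrow> 'e"
  where "transition c d = snd d \<circ> chart_inv c"

text \<open>The manifold is the whole type \<open>'a\<close>; the atlas need not be maximal.\<close>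

definition smooth_atlas :: "('a::topological_space, 'e::euclidean_space) chart set \<Rightarrow> bool"
  where "smooth_atlas \<A> \<longleftrightarrow> (\<forall>c\<in>\<A>. is_chart c) \<and> (\<Union>c\<in>\<A>. fst c) = UNIV \<and>
           (\<forall>c\<in>\<A>. \<forall>d\<in>\<A>. smooth_on (snd c ` (fst c \<inter> fst d)) (transition c d))"


section \<open>Tangent vectors, vector fields, Lie brackets\<close>

text \<open>A tangent vector at \<open>q\<close> is the family of its components in all charts around \<open>q\<close>,
  transforming by the Jacobians of the coordinate changes, and padded by \<open>0\<close> at the charts
  that do not contain \<open>q\<close>.\<close>

type_synonym ('a, 'e) tvec = "('a, 'e) chart \<Rightarrow> 'e"
type_synonym ('a, 'e) vfield = "'a \<Rightarrow> ('a, 'e) tvec"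

definition tangent_space ::
    "('a::topological_space, 'e::euclidean_space) chart set \<Rightarrow> 'a \<Rightarrow> ('a, 'e) tvec set"
  where "tangent_space \<A> q = {v.
           (\<forall>c. \<not> (c \<in> \<A> \<and> q \<in> fst c) \<longrightarrow> v c = 0) \<and>
           (\<forall>c\<in>\<A>. \<forall>d\<in>\<A>. q \<in> fst c \<inter> fst d \<longrightarrow>
              v d = frechet_derivative (transition c d) (at (snd c q)) (v c))}"

definition local_rep :: "('a, 'e) vfield \<Rightarrow> ('a, 'e) chart \<Rightarrow> 'e \<Rightarrow> 'e"
  where "local_rep X c = (\<lambda>x. X (chart_inv c x) c)"

definition smooth_vfield_on :: "('a::topological_space, 'e::euclidean_space) chart set \<Rightarrow>
    'a set \<Rightarrow> ('a, 'e) vfield \<Rightarrow> bool"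
  where "smooth_vfield_on \<A> W X \<longleftrightarrow> (\<forall>q\<in>W. X q \<in> tangent_space \<A> q) \<and>
           (\<forall>c\<in>\<A>. smooth_on (snd c ` (fst c \<inter> W)) (local_rep X c))"

definition lie_bracket :: "('a::topological_space, 'e::euclidean_space) chart set \<Rightarrow>
    ('a, 'e) vfield \<Rightarrow> ('a, 'e) vfield \<Rightarrow> ('a, 'e) vfield"
  where "lie_bracket \<A> X Y = (\<lambda>q c.
           if c \<in> \<A> \<and> q \<in> fst c
           then frechet_derivative (local_rep Y c) (at (snd c q)) (X q c)
              - frechet_derivative (local_rep X c) (at (snd c q)) (Y q c)
           else 0)"

inductive_set lie_algebra :: "('a::topological_space, 'e::euclidean_space) chart set \<Rightarrow>
    ('a, 'e) vfield set \<Rightarrow> ('a, 'e) vfield set"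
  for \<A> :: "('a, 'e) chart set" and \<X> :: "('a, 'e) vfield set"
where
  generator: "X \<in> \<X> \<Longrightarrow> X \<in> lie_algebra \<A> \<X>"
| zero: "0 \<in> lie_algebra \<A> \<X>"
| add: "X \<in> lie_algebra \<A> \<X> \<Longrightarrow> Y \<in> lie_algebra \<A> \<X> \<Longrightarrow> X + Y \<in> lie_algebra \<A> \<X>"
| scale: "X \<in> lie_algebra \<A> \<X> \<Longrightarrow> r *\<^sub>R X \<in> lie_algebra \<A> \<X>"
| bracket: "X \<in> lie_algebra \<A> \<X> \<Longrightarrow> Y \<in> lie_algebra \<A> \<X> \<Longrightarrow>
    lie_bracket \<A> X Y \<in> lie_algebra \<A> \<X>"

text \<open>The curve \<open>\<gamma>\<close> has velocity \<open>v\<close> at time \<open>t\<close> (relative to the time set \<open>S\<close>).\<close>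

definition has_velocity :: "('a::topological_space, 'e::euclidean_space) chart set \<Rightarrow>
    (real \<Rightarrow> 'a) \<Rightarrow> ('a, 'e) tvec \<Rightarrow> real \<Rightarrow> real set \<Rightarrow> bool"
  where "has_velocity \<A> \<gamma> v t S \<longleftrightarrow>
           (\<forall>c\<in>\<A>. \<gamma> t \<in> fst c \<longrightarrow> ((snd c \<circ> \<gamma>) has_vector_derivative v c) (at t within S))"

definition one_parameter_group :: "('a::topological_space, 'e::euclidean_space) chart set \<Rightarrow>
    (real \<Rightarrow> 'a \<Rightarrow> 'a) \<Rightarrow> bool"
  where "one_parameter_group \<A> P \<longleftrightarrow>
           P 0 = id \<and> (\<forall>s t. P (s + t) = P s \<circ> P t) \<and>
           continuous_on UNIV (\<lambda>(t, q). P t q) \<and>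
           (\<forall>c\<in>\<A>. \<forall>d\<in>\<A>.
              smooth_on {(t, x). x \<in> chart_img c \<and> P t (chart_inv c x) \<in> fst d}
                        (\<lambda>(t, x). snd d (P t (chart_inv c x))))"

definition generates :: "('a::topological_space, 'e::euclidean_space) chart set \<Rightarrow>
    ('a, 'e) vfield \<Rightarrow> (real \<Rightarrow> 'a \<Rightarrow> 'a) \<Rightarrow> bool"
  where "generates \<A> X P \<longleftrightarrow> one_parameter_group \<A> P \<and>
           (\<forall>q t. has_velocity \<A> (\<lambda>s. P s q) (X (P t q)) t UNIV)"


section \<open>Control systems, trajectories, controllability\<close>

definition absolutely_continuous_curve ::
    "real \<Rightarrow> real \<Rightarrow> (real \<Rightarrow> 'e::real_normed_vector) \<Rightarrow> bool"
  where "absolutely_continuous_curve a b f \<longleftrightarrow>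
           (\<forall>\<epsilon>>0. \<exists>\<delta>>0. \<forall>(m::nat) s t.
              (\<forall>i<m. a \<le> s i \<and> s i \<le> t i \<and> t i \<le> b) \<and>
              (\<forall>i<m. \<forall>j<m. i \<noteq> j \<longrightarrow> {s i<..<t i} \<inter> {s j<..<t j} = {}) \<and>
              (\<Sum>i<m. t i - s i) < \<delta> \<longrightarrow>
              (\<Sum>i<m. norm (f (t i) - f (s i))) < \<epsilon>)"

text \<open>Solutions are understood in the sense of Caratheodory: \<open>\<gamma>\<close> is absolutely continuous
  on \<open>{0..T}\<close> and satisfies the differential equation at almost every time.\<close>

definition trajectory_under :: "('a::topological_space, 'e::euclidean_space) chart set \<Rightarrow>
    ('u \<Rightarrow> ('a, 'e) vfield) \<Rightarrow> (real \<Rightarrow> 'u) \<Rightarrow> (real \<Rightarrow> 'a) \<Rightarrow> real \<Rightarrow> bool"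
  where "trajectory_under \<A> V u \<gamma> T \<longleftrightarrow>
           0 \<le> T \<and> continuous_on {0..T} \<gamma> \<and>
           (\<forall>c\<in>\<A>. \<forall>a b. 0 \<le> a \<and> a \<le> b \<and> b \<le> T \<and> \<gamma> ` {a..b} \<subseteq> fst c \<longrightarrow>
              absolutely_continuous_curve a b (snd c \<circ> \<gamma>)) \<and>
           (AE t in lebesgue. t \<in> {0..T} \<longrightarrow> has_velocity \<A> \<gamma> (V (u t) (\<gamma> t)) t {0..T})"

definition trajectory :: "('a::topological_space, 'e::euclidean_space) chart set \<Rightarrow>
    ('u \<Rightarrow> ('a, 'e) vfield) \<Rightarrow> (real \<Rightarrow> 'u) set \<Rightarrow> (real \<Rightarrow> 'a) \<Rightarrow> real \<Rightarrow> bool"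
  where "trajectory \<A> V \<U> \<gamma> T \<longleftrightarrow> (\<exists>u\<in>\<U>. trajectory_under \<A> V u \<gamma> T)"

definition piecewise_constant :: "(real \<Rightarrow> 'u) \<Rightarrow> bool"
  where "piecewise_constant u \<longleftrightarrow>
           (\<forall>T. \<exists>S. finite S \<and>
              (\<forall>a b. - T \<le> a \<and> b \<le> T \<and> {a<..<b} \<inter> S = {} \<longrightarrow> u constant_on {a<..<b}))"

definition piecewise_constant_controls :: "'u set \<Rightarrow> (real \<Rightarrow> 'u) set"
  where "piecewise_constant_controls U = {u. piecewise_constant u \<and> range u \<subseteq> U}"

text \<open>Controls are approximated almost everywhere (for \<open>L\<^sup>1\<close> approximation pass to a
  subsequence). Curves are approximated uniformly on \<open>{0..T}\<close>, expressed without a metric by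
  neighbourhoods of the graph.\<close>

definition approximable_by_piecewise_constant ::
    "('a::topological_space, 'e::euclidean_space) chart set \<Rightarrow>
     'u::topological_space set \<Rightarrow> ('u \<Rightarrow> ('a, 'e) vfield) \<Rightarrow> (real \<Rightarrow> 'u) set \<Rightarrow> bool"
  where "approximable_by_piecewise_constant \<A> U V \<U> \<longleftrightarrow>
           (\<forall>u\<in>\<U>. \<forall>\<gamma> T. trajectory_under \<A> V u \<gamma> T \<longrightarrow>
              (\<exists>w \<eta>. (\<forall>k::nat. w k \<in> piecewise_constant_controls U \<and>
                               trajectory_under \<A> V (w k) (\<eta> k) T \<and> \<eta> k 0 = \<gamma> 0) \<and>
                     (AE t in lebesgue. t \<in> {0..T} \<longrightarrow> (\<lambda>k. w k t) \<longlonglongrightarrow> u t) \<and>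
                     (\<forall>W. open W \<and> (\<lambda>t. (t, \<gamma> t)) ` {0..T} \<subseteq> W \<longrightarrow>
                        (\<forall>\<^sub>F k in sequentially. (\<lambda>t. (t, \<eta> k t)) ` {0..T} \<subseteq> W))))"

text \<open>\<open>\<U>\<close> is the class of admissible control functions, for instance all locally integrable
  functions with values in a subset \<open>U\<close> of a Euclidean space.\<close>

definition control_system :: "('a::topological_space, 'e::euclidean_space) chart set \<Rightarrow>
    'u::topological_space set \<Rightarrow> ('u \<Rightarrow> ('a, 'e) vfield) \<Rightarrow> (real \<Rightarrow> 'u) set \<Rightarrow> bool"
  where "control_system \<A> U V \<U> \<longleftrightarrow>
           smooth_atlas \<A> \<and>
           (\<forall>u\<in>U. smooth_vfield_on \<A> UNIV (V u) \<and> (\<exists>P. generates \<A> (V u) P)) \<and>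
           (\<forall>u\<in>\<U>. range u \<subseteq> U) \<and>
           piecewise_constant_controls U \<subseteq> \<U> \<and>
           approximable_by_piecewise_constant \<A> U V \<U>"

definition controllable :: "('a::topological_space, 'e::euclidean_space) chart set \<Rightarrow>
    ('u \<Rightarrow> ('a, 'e) vfield) \<Rightarrow> (real \<Rightarrow> 'u) set \<Rightarrow> bool"
  where "controllable \<A> V \<U> \<longleftrightarrow>
           (\<forall>p p'. \<exists>\<gamma> T. trajectory \<A> V \<U> \<gamma> T \<and> \<gamma> 0 = p \<and> \<gamma> T = p')"


section \<open>Rank condition and ampleness\<close>

definition LARC_at :: "('a::topological_space, 'e::euclidean_space) chart set \<Rightarrow>
    'u set \<Rightarrow> ('u \<Rightarrow> ('a, 'e) vfield) \<Rightarrow> 'a \<Rightarrow> bool"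
  where "LARC_at \<A> U V q \<longleftrightarrow>
           (\<exists>F. finite F \<and> F \<subseteq> U \<and>
              (\<lambda>X. X q) ` lie_algebra \<A> (V ` F) = tangent_space \<A> q)"

definition control_vectors :: "'u set \<Rightarrow> ('u \<Rightarrow> ('a, 'e) vfield) \<Rightarrow> 'a \<Rightarrow> ('a, 'e) tvec set"
  where "control_vectors U V q = {V u q | u. u \<in> U}"

definition control_span ::
    "'u set \<Rightarrow> ('u \<Rightarrow> ('a, 'e::euclidean_space) vfield) \<Rightarrow> 'a \<Rightarrow> ('a, 'e) tvec set"
  where "control_span U V q = span (control_vectors U V q)"

definition smooth_subbundle_on :: "('a::topological_space, 'e::euclidean_space) chart set \<Rightarrow>
    'a set \<Rightarrow> ('a \<Rightarrow> ('a, 'e) tvec set) \<Rightarrow> bool"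
  where "smooth_subbundle_on \<A> B L \<longleftrightarrow>
           (\<forall>p\<in>B. \<exists>W (r::nat) X. open W \<and> p \<in> W \<and> W \<subseteq> B \<and>
              (\<forall>i<r. smooth_vfield_on \<A> W (X i)) \<and>
              (\<forall>p'\<in>W. inj_on (\<lambda>i. X i p') {..<r} \<and>
                      independent ((\<lambda>i. X i p') ` {..<r}) \<and>
                      span ((\<lambda>i. X i p') ` {..<r}) = L p'))"

text \<open>Open subsets of the tangent bundle. The topology is the one given by the bundle charts,
  not the product topology on functions of charts.\<close>

definition tangent_bundle_open :: "('a::topological_space, 'e::euclidean_space) chart set \<Rightarrow>
    ('a \<times> ('a, 'e) tvec) set \<Rightarrow> bool"
  where "tangent_bundle_open \<A> N \<longleftrightarrow> N \<subseteq> (SIGMA q:UNIV. tangent_space \<A> q) \<and>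
           (\<forall>c\<in>\<A>. open {(snd c q, v c) | q v. (q, v) \<in> N \<and> q \<in> fst c})"

definition control_vectors_open_at :: "('a::topological_space, 'e::euclidean_space) chart set \<Rightarrow>
    'u set \<Rightarrow> ('u \<Rightarrow> ('a, 'e) vfield) \<Rightarrow> 'a \<Rightarrow> bool"
  where "control_vectors_open_at \<A> U V q \<longleftrightarrow>
           (\<exists>B. open B \<and> q \<in> B \<and>
              (\<exists>r. \<forall>p\<in>B. dim (control_span U V p) = r) \<and>
              smooth_subbundle_on \<A> B (control_span U V) \<and>
              (\<exists>N. tangent_bundle_open \<A> N \<and>
                 (SIGMA p:B. control_vectors U V p) = N \<inter> (SIGMA p:B. control_span U V p)))"

definition ample_at :: "('a::topological_space, 'e::euclidean_space) chart set \<Rightarrow>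
    'u set \<Rightarrow> ('u \<Rightarrow> ('a, 'e) vfield) \<Rightarrow> 'a \<Rightarrow> bool"
  where "ample_at \<A> U V q \<longleftrightarrow> control_vectors_open_at \<A> U V q \<and>
           convex hull (control_vectors U V q) = control_span U V q"

end

theory Submission
  imports Defs
begin

text \<open>Ampleness and the rank condition already force every point to be reachable from every other one by
following finitely many of the flows \<open>P u\<close> for nonnegative times. Both sides of the equivalence follow
from this: concatenated flow lines are trajectories with piecewise constant controls, and a closed
trajectory through \<open>q\<close> arises by reaching \<open>P u (- 1) q\<close> from \<open>q\<close> and then following \<open>P u\<close> for time \<open>1\<close>.
Two facts carry the argument.

The first is Krener's theorem: under the rank condition, a nonempty set that is invariant under all
flows in positive time (or all in negative time) has interior points (\<open>krener\<close>,
\<open>krener_manifold\<close>). Consider smooth maps from the model space into the set and choose one whose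
derivative \<open>A\<close> at \<open>0\<close> has maximal rank. Flowing for a time that depends on the parameter would raise
the rank unless every control field is tangent to the range of \<open>A\<close>. As the flows transport maximal
maps to maximal maps, differentiating along the flows gives the same for the brackets with control
fields, and the Jacobi identity gives it for the whole generated Lie algebra. By the rank condition
\<open>A\<close> is onto, so the map is open at \<open>0\<close>.

The second is that a closed set which is invariant in positive time is also invariant in negative
time (\<open>backward_invariant\<close>). At a point of the set every proximal normal forms a nonpositive inner
product with all control vectors, hence with their convex hull; by ampleness this hull is a linear
space and contains the opposite velocities. A Gronwall estimate for the squared distance to the set
(\<open>bony_brezis\<close>) then shows that the reversed flow lines do not leave it.

Applied to the closure of the set reachable from \<open>p\<close>, the second fact makes this closure invariant under
the full groups \<open>P u\<close>. The first one gives interior points of the closure that are reachable from any of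
its points, and pulling them back along the flows shows that the closure is open; by connectedness
it is everything. So the points reachable from \<open>p\<close> are dense, while the set of points from which \<open>q\<close> is
reachable has interior by the first fact with time reversed. The two sets meet, hence \<open>q\<close> is reachable
from \<open>p\<close>.\<close>

section \<open>Calculus of smooth maps\<close>

abbreviation dirder :: "('a::real_normed_vector \<Rightarrow> 'b::real_normed_vector) \<Rightarrow> 'a \<Rightarrow> 'a \<Rightarrow> 'b"
  where "dirder f x \<equiv> frechet_derivative f (at x)"

lemma Ck_on_Suc_imp: "Ck_on (Suc k) S f \<Longrightarrow> Ck_on k S f"
proof (induction k arbitrary: f)
  case 0
  then show ?case
    by (auto intro!: continuous_at_imp_continuous_on differentiable_imp_continuous_within)
next
  case (Suc k)
  then show ?case by (metis Ck_on.simps(2))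
qed

lemma has_derivative_cong_open:
  assumes "open S" "\<And>x. x \<in> S \<Longrightarrow> f x = g x" "x \<in> S"
  shows "(f has_derivative D) (at x) \<longleftrightarrow> (g has_derivative D) (at x)"
  using assms by (metis has_derivative_transform_within_open)

lemma dirder_cong_open:
  assumes "open S" "\<And>x. x \<in> S \<Longrightarrow> f x = g x" "x \<in> S"
  shows "dirder f x = dirder g x"
  unfolding frechet_derivative_def using has_derivative_cong_open[OF assms] by simp

lemma differentiable_cong_open:
  assumes "open S" "\<And>x. x \<in> S \<Longrightarrow> f x = g x" "x \<in> S"
  shows "f differentiable (at x) \<longleftrightarrow> g differentiable (at x)"
  unfolding differentiable_def using has_derivative_cong_open[OF assms] by simp

lemma Ck_on_cong:
  assumes "open S" "\<And>x. x \<in> S \<Longrightarrow> f x = g x"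
  shows "Ck_on k S f \<longleftrightarrow> Ck_on k S g"
  using assms(2)
proof (induction k arbitrary: f g)
  case 0
  then show ?case by (simp cong: continuous_on_cong)
next
  case (Suc k)
  have "Ck_on k S (\<lambda>x. dirder f x v) \<longleftrightarrow> Ck_on k S (\<lambda>x. dirder g x v)" for v
    by (rule Suc.IH) (simp add: dirder_cong_open[OF assms(1) Suc.prems])
  then show ?case
    using differentiable_cong_open[OF assms(1) Suc.prems] by auto
qed

lemma dirder_has_derivative:
  "f differentiable (at x) \<Longrightarrow> (f has_derivative dirder f x) (at x)"
  by (simp add: frechet_derivative_works)

lemma dirder_eq: "(f has_derivative D) (at x) \<Longrightarrow> dirder f x = D"
  using frechet_derivative_at by metis

lemma Ck_on_const: "Ck_on k S (\<lambda>x. c)"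
  by (induction k arbitrary: c) auto

lemma Ck_on_add:
  assumes "open S" "Ck_on k S f" "Ck_on k S g"
  shows "Ck_on k S (\<lambda>x. f x + g x)"
  using assms(2,3)
proof (induction k arbitrary: f g)
  case 0
  then show ?case by (simp add: continuous_on_add)
next
  case (Suc k)
  have D: "((\<lambda>x. f x + g x) has_derivative (\<lambda>v. dirder f x v + dirder g x v)) (at x)" if "x \<in> S" for x
    using Suc.prems that by (auto intro!: has_derivative_add dirder_has_derivative)
  have "Ck_on k S (\<lambda>x. dirder (\<lambda>x. f x + g x) x v)" for v
  proof -
    have "Ck_on k S (\<lambda>x. dirder f x v + dirder g x v)"
      using Suc.prems by (intro Suc.IH) auto
    then show ?thesis
      by (rule iffD1[OF Ck_on_cong[OF assms(1)], rotated]) (simp add: dirder_eq[OF D])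
  qed
  then show ?case using D by (auto simp: differentiable_def)
qed

lemma Ck_on_bilinear:
  assumes "bounded_bilinear m" "open S" "Ck_on k S f" "Ck_on k S g"
  shows "Ck_on k S (\<lambda>x. m (f x) (g x))"
  using assms(3,4)
proof (induction k arbitrary: f g)
  case 0
  then show ?case by (simp add: bounded_bilinear.continuous_on[OF assms(1)])
next
  case (Suc k)
  have D: "((\<lambda>x. m (f x) (g x)) has_derivative (\<lambda>v. m (f x) (dirder g x v) + m (dirder f x v) (g x))) (at x)"
    if "x \<in> S" for x
    using Suc.prems that
    by (auto intro!: bounded_bilinear.FDERIV[OF assms(1)] dirder_has_derivative)
  have "Ck_on k S (\<lambda>x. dirder (\<lambda>x. m (f x) (g x)) x v)" for v
  proof -
    have "Ck_on k S (\<lambda>x. m (f x) (dirder g x v) + m (dirder f x v) (g x))"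
      using Suc.prems Suc.prems[THEN Ck_on_Suc_imp] by (intro Ck_on_add Suc.IH assms(2)) simp_all
    then show ?thesis
      by (rule iffD1[OF Ck_on_cong[OF assms(2)], rotated]) (simp add: dirder_eq[OF D])
  qed
  then show ?case using D by (auto simp: differentiable_def)
qed

lemma smooth_on_cong:
  "open S \<Longrightarrow> (\<And>x. x \<in> S \<Longrightarrow> f x = g x) \<Longrightarrow> smooth_on S f \<longleftrightarrow> smooth_on S g"
  unfolding smooth_on_def using Ck_on_cong by metis

lemma smooth_on_const: "smooth_on S (\<lambda>x. c)"
  by (simp add: smooth_on_def Ck_on_const)

lemma smooth_on_add:
  "open S \<Longrightarrow> smooth_on S f \<Longrightarrow> smooth_on S g \<Longrightarrow> smooth_on S (\<lambda>x. f x + g x)"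
  by (simp add: smooth_on_def Ck_on_add)

lemma smooth_on_bilinear:
  "bounded_bilinear m \<Longrightarrow> open S \<Longrightarrow> smooth_on S f \<Longrightarrow> smooth_on S g \<Longrightarrow> smooth_on S (\<lambda>x. m (f x) (g x))"
  by (simp add: smooth_on_def Ck_on_bilinear)

lemma smooth_on_scaleR:
  "open S \<Longrightarrow> smooth_on S f \<Longrightarrow> smooth_on S (\<lambda>x. r *\<^sub>R f x)"
  using smooth_on_bilinear[OF bounded_bilinear_scaleR _ smooth_on_const] .

lemma smooth_on_sum:
  "open S \<Longrightarrow> (\<And>i. i \<in> I \<Longrightarrow> smooth_on S (f i)) \<Longrightarrow> smooth_on S (\<lambda>x. \<Sum>i\<in>I. f i x)"
  by (induction I rule: infinite_finite_induct) (auto simp: smooth_on_const smooth_on_add)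

lemma smooth_on_dirder: "smooth_on S f \<Longrightarrow> smooth_on S (\<lambda>x. dirder f x v)"
  unfolding smooth_on_def by (metis Ck_on.simps(2))

lemma smooth_on_imp_has_derivative:
  "smooth_on S f \<Longrightarrow> x \<in> S \<Longrightarrow> (f has_derivative dirder f x) (at x)"
  unfolding smooth_on_def by (metis Ck_on.simps(2) dirder_has_derivative)

lemma smooth_on_imp_continuous_on: "smooth_on S f \<Longrightarrow> continuous_on S f"
  unfolding smooth_on_def by (metis Ck_on.simps(1))

lemma smooth_on_linear_dirder:
  "smooth_on S f \<Longrightarrow> x \<in> S \<Longrightarrow> linear (dirder f x)"
  using smooth_on_imp_has_derivative has_derivative_linear by blast

lemma tendsto_difference_quotient:
  fixes F :: "real \<Rightarrow> 'b::real_normed_vector"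
  assumes "(F has_vector_derivative D) (at_right 0)"
  shows "((\<lambda>s. (1 / s) *\<^sub>R (F s - F 0)) \<longlongrightarrow> D) (at_right 0)"
proof -
  have "((\<lambda>s. (1 / norm (s - 0)) *\<^sub>R (F s - (F 0 + (s - 0) *\<^sub>R D))) \<longlongrightarrow> 0) (at_right 0)"
    using assms unfolding has_vector_derivative_def has_derivative_within by blast
  then have "((\<lambda>s. (1 / norm (s - 0)) *\<^sub>R (F s - (F 0 + (s - 0) *\<^sub>R D)) + D) \<longlongrightarrow> 0 + D) (at_right 0)"
    by (intro tendsto_add tendsto_const)
  moreover have "\<forall>\<^sub>F s in at_right 0. (1 / norm (s - 0)) *\<^sub>R (F s - (F 0 + (s - 0) *\<^sub>R D)) + D = (1 / s) *\<^sub>R (F s - F 0)"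
    using eventually_at_right_less[of 0]
    by eventually_elim (simp add: algebra_simps)
  ultimately show ?thesis using tendsto_cong by force
qed

text \<open>Two applications of the mean value theorem turn the second difference over the parallelogram spanned by
\<open>h v\<close> and \<open>h w\<close> into \<open>h\<^sup>2\<close> times a value of the mixed derivative at a nearby point. As the second
difference is symmetric in \<open>v\<close> and \<open>w\<close>, so is the limit.\<close>

lemma second_difference_quotient:
  fixes f :: "'a::real_normed_vector \<Rightarrow> real"
  assumes S: "open S" "x \<in> S"
    and f: "\<And>y. y \<in> S \<Longrightarrow> (f has_derivative f' y) (at y)"
    and g: "\<And>y. y \<in> S \<Longrightarrow> ((\<lambda>y. f' y v) has_derivative g y) (at y)"
    and c: "isCont (\<lambda>y. g y w) x"
  shows "((\<lambda>h. (f (x + h *\<^sub>R v + h *\<^sub>R w) - f (x + h *\<^sub>R v) - f (x + h *\<^sub>R w) + f x) / h\<^sup>2)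
           \<longlongrightarrow> g x w) (at_right 0)"
proof (rule tendstoI)
  fix e :: real assume "e > 0"
  then obtain d1 where d1: "d1 > 0" "\<And>y. dist y x < d1 \<Longrightarrow> dist (g y w) (g x w) < e"
    using c unfolding continuous_at_eps_delta by blast
  obtain d2 where d2: "d2 > 0" "ball x d2 \<subseteq> S"
    using S openE by blast
  define d where "d = min d1 d2 / (norm v + norm w + 1)"
  have nn: "norm v + norm w + 1 > 0" by (smt (verit) norm_ge_zero)
  have "d > 0" using d1(1) d2(1) nn by (simp add: d_def)
  have near: "dist (x + s *\<^sub>R v + t *\<^sub>R w) x < min d1 d2" if "0 \<le> s" "s \<le> h" "0 \<le> t" "t \<le> h" "h < d" for s t h
  proof -
    have "dist (x + s *\<^sub>R v + t *\<^sub>R w) x \<le> s * norm v + t * norm w"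
      using that norm_triangle_ineq[of "s *\<^sub>R v" "t *\<^sub>R w"] by (simp add: dist_norm)
    also have "\<dots> \<le> h * norm v + h * norm w"
      using that by (intro add_mono mult_right_mono) auto
    also have "\<dots> \<le> h * (norm v + norm w + 1)" using that by (simp add: algebra_simps)
    also have "\<dots> < d * (norm v + norm w + 1)" using that nn by (intro mult_strict_right_mono)
    also have "\<dots> = min d1 d2" using nn by (simp add: d_def)
    finally show ?thesis .
  qed
  have inS: "x + s *\<^sub>R v + t *\<^sub>R w \<in> S" if "0 \<le> s" "s \<le> h" "0 \<le> t" "t \<le> h" "h < d" for s t h
    using near[OF that] d2(2) by (auto simp: dist_commute)
  have key: "dist ((f (x + h *\<^sub>R v + h *\<^sub>R w) - f (x + h *\<^sub>R v) - f (x + h *\<^sub>R w) + f x) / h\<^sup>2) (g x w) < e"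
    if h: "0 < h" "h < d" for h
  proof -
    define \<phi> where "\<phi> s = f (x + s *\<^sub>R v + h *\<^sub>R w) - f (x + s *\<^sub>R v + 0 *\<^sub>R w)" for s
    have D: "((\<lambda>s. f (x + s *\<^sub>R v + t *\<^sub>R w)) has_derivative (\<lambda>r. f' (x + s *\<^sub>R v + t *\<^sub>R w) (r *\<^sub>R v))) (at s)"
      if "0 \<le> s" "s \<le> h" "0 \<le> t" "t \<le> h" for s t
      by (rule has_derivative_compose[where f="\<lambda>s. x + s *\<^sub>R v + t *\<^sub>R w", OF _ f[OF inS[OF that h(2)]]])
         (auto intro!: derivative_eq_intros)
    have lin: "linear (f' (x + s *\<^sub>R v + t *\<^sub>R w))" if "0 \<le> s" "s \<le> h" "0 \<le> t" "t \<le> h" for s t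
      using f[OF inS[OF that h(2)]] has_derivative_linear by blast
    have D': "((\<lambda>s. f (x + s *\<^sub>R v + t *\<^sub>R w)) has_real_derivative f' (x + s *\<^sub>R v + t *\<^sub>R w) v) (at s)"
      if "0 \<le> s" "s \<le> h" "0 \<le> t" "t \<le> h" for s t
      unfolding has_field_derivative_def
      using D[OF that] linear_scale[OF lin[OF that]] by (simp add: mult.commute[of _ "f' _ _"] mult_commute_abs)
    have "\<exists>s. 0 < s \<and> s < h \<and> \<phi> h - \<phi> 0 = (h - 0) * (f' (x + s *\<^sub>R v + h *\<^sub>R w) v - f' (x + s *\<^sub>R v + 0 *\<^sub>R w) v)"
      unfolding \<phi>_def by (rule MVT2[OF h(1)]) (use h in \<open>intro DERIV_diff D'; simp\<close>)
    then obtain s where s: "0 < s" "s < h" "\<phi> h - \<phi> 0 = h * (f' (x + s *\<^sub>R v + h *\<^sub>R w) v - f' (x + s *\<^sub>R v + 0 *\<^sub>R w) v)"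
      by auto
    have E: "((\<lambda>t. f' (x + s *\<^sub>R v + t *\<^sub>R w) v) has_real_derivative g (x + s *\<^sub>R v + t *\<^sub>R w) w) (at t)"
      if "0 \<le> t" "t \<le> h" for t
    proof -
      have i: "x + s *\<^sub>R v + t *\<^sub>R w \<in> S" using inS[of s h t] s h that by auto
      have "((\<lambda>t. f' (x + s *\<^sub>R v + t *\<^sub>R w) v) has_derivative (\<lambda>r. g (x + s *\<^sub>R v + t *\<^sub>R w) (r *\<^sub>R w))) (at t)"
        by (rule has_derivative_compose[where f="\<lambda>t. x + s *\<^sub>R v + t *\<^sub>R w", OF _ g[OF i]])
           (auto intro!: derivative_eq_intros)
      moreover have "linear (g (x + s *\<^sub>R v + t *\<^sub>R w))" using g[OF i] has_derivative_linear by blast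
      ultimately show ?thesis
        unfolding has_field_derivative_def
        by (simp add: linear_scale mult.commute[of _ "g _ _"] mult_commute_abs)
    qed
    obtain t where t: "0 < t" "t < h"
      "f' (x + s *\<^sub>R v + h *\<^sub>R w) v - f' (x + s *\<^sub>R v + 0 *\<^sub>R w) v = (h - 0) * g (x + s *\<^sub>R v + t *\<^sub>R w) w"
      using MVT2[OF h(1), of "\<lambda>t. f' (x + s *\<^sub>R v + t *\<^sub>R w) v" "\<lambda>t. g (x + s *\<^sub>R v + t *\<^sub>R w) w"] E
      by blast
    have "f (x + h *\<^sub>R v + h *\<^sub>R w) - f (x + h *\<^sub>R v) - f (x + h *\<^sub>R w) + f x = \<phi> h - \<phi> 0"
      by (simp add: \<phi>_def)
    also have "\<dots> = h\<^sup>2 * g (x + s *\<^sub>R v + t *\<^sub>R w) w"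
      using s t by (simp add: power2_eq_square)
    finally have "(f (x + h *\<^sub>R v + h *\<^sub>R w) - f (x + h *\<^sub>R v) - f (x + h *\<^sub>R w) + f x) / h\<^sup>2 = g (x + s *\<^sub>R v + t *\<^sub>R w) w"
      using h by simp
    then show ?thesis
      using d1(2)[of "x + s *\<^sub>R v + t *\<^sub>R w"] near[of s h t] s t h by auto
  qed
  show "\<forall>\<^sub>F h in at_right 0. dist ((f (x + h *\<^sub>R v + h *\<^sub>R w) - f (x + h *\<^sub>R v) - f (x + h *\<^sub>R w) + f x) / h\<^sup>2) (g x w) < e"
    unfolding eventually_at_right_field using \<open>d > 0\<close> key by auto
qed

lemma dirder_symmetric_real:
  fixes f :: "'a::real_normed_vector \<Rightarrow> real"
  assumes "open S" "smooth_on S f" "x \<in> S"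
  shows "dirder (\<lambda>y. dirder f y v) x w = dirder (\<lambda>y. dirder f y w) x v"
proof -
  note d = smooth_on_imp_has_derivative
  have cont: "isCont (\<lambda>y. dirder (\<lambda>y. dirder f y v) y w) x" for v w
    using smooth_on_imp_continuous_on[OF smooth_on_dirder[OF smooth_on_dirder[OF assms(2)]]] assms
    by (simp add: continuous_on_eq_continuous_at)
  have "((\<lambda>h. (f (x + h *\<^sub>R v + h *\<^sub>R w) - f (x + h *\<^sub>R v) - f (x + h *\<^sub>R w) + f x) / h\<^sup>2)
           \<longlongrightarrow> dirder (\<lambda>y. dirder f y v) x w) (at_right 0)" for v w
    by (rule second_difference_quotient[OF assms(1,3) d[OF assms(2)] d[OF smooth_on_dirder[OF assms(2)]] cont])
  from this[of v w] this[of w v] show ?thesis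
    by (intro tendsto_unique[of "at_right (0::real)"])
       (auto simp: algebra_simps)
qed

lemma dirder_inner:
  "f differentiable (at x) \<Longrightarrow> dirder (\<lambda>y. f y \<bullet> b) x v = dirder f x v \<bullet> b"
  by (rule fun_cong[OF dirder_eq, of _ _ _ v]) (rule has_derivative_inner_left[OF dirder_has_derivative])

lemma dirder_symmetric:
  fixes f :: "'a::real_normed_vector \<Rightarrow> 'b::euclidean_space"
  assumes "open S" "smooth_on S f" "x \<in> S"
  shows "dirder (\<lambda>y. dirder f y v) x w = dirder (\<lambda>y. dirder f y w) x v"
proof (rule euclidean_eqI)
  fix b :: 'b assume "b \<in> Basis"
  have sm: "smooth_on S (\<lambda>y. f y \<bullet> b)"
    by (rule smooth_on_bilinear[OF bounded_bilinear_inner assms(1,2) smooth_on_const])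
  have diff: "g differentiable (at y)" if "smooth_on S g" "y \<in> S" for g :: "'a \<Rightarrow> 'b" and y
    using smooth_on_imp_has_derivative[OF that] by (auto simp: differentiable_def)
  have *: "dirder (\<lambda>y. dirder f y v) x w \<bullet> b = dirder (\<lambda>y. dirder (\<lambda>y. f y \<bullet> b) y v) x w" for v w
  proof -
    have "dirder (\<lambda>y. dirder f y v) x w \<bullet> b = dirder (\<lambda>y. dirder f y v \<bullet> b) x w"
      using diff[OF smooth_on_dirder[OF assms(2)] assms(3)] by (simp add: dirder_inner)
    also have "dirder (\<lambda>y. dirder f y v \<bullet> b) x = dirder (\<lambda>y. dirder (\<lambda>y. f y \<bullet> b) y v) x"
      using diff[OF assms(2)] by (intro dirder_cong_open[OF assms(1) _ assms(3)]) (simp add: dirder_inner)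
    finally show ?thesis .
  qed
  show "dirder (\<lambda>y. dirder f y v) x w \<bullet> b = dirder (\<lambda>y. dirder f y w) x v \<bullet> b"
    unfolding * by (rule dirder_symmetric_real[OF assms(1) sm assms(3)])
qed

section \<open>Brackets of vector fields on Euclidean space\<close>

definition vf_bracket :: "('e::euclidean_space \<Rightarrow> 'e) \<Rightarrow> ('e \<Rightarrow> 'e) \<Rightarrow> 'e \<Rightarrow> 'e"
  where "vf_bracket X Y x = dirder Y x (X x) - dirder X x (Y x)"

lemma linear_in_coordinates:
  fixes D :: "'e::euclidean_space \<Rightarrow> 'b::real_vector"
  assumes "linear D"
  shows "(\<Sum>b\<in>Basis. (v \<bullet> b) *\<^sub>R D b) = D v"
proof -
  have "D v = D (\<Sum>b\<in>Basis. (v \<bullet> b) *\<^sub>R b)" by (simp add: euclidean_representation)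
  also have "\<dots> = (\<Sum>b\<in>Basis. (v \<bullet> b) *\<^sub>R D b)" by (simp add: linear_sum[OF assms] linear_scale[OF assms])
  finally show ?thesis by simp
qed

lemma smooth_on_dirder_field:
  fixes X :: "'e::euclidean_space \<Rightarrow> 'e"
  assumes "open S" "smooth_on S X" "smooth_on S Y"
  shows "smooth_on S (\<lambda>x. dirder Y x (X x))"
proof -
  have "smooth_on S (\<lambda>x. \<Sum>b\<in>Basis. (X x \<bullet> b) *\<^sub>R dirder Y x b)"
    by (intro smooth_on_sum smooth_on_bilinear[OF bounded_bilinear_scaleR]
        smooth_on_bilinear[OF bounded_bilinear_inner] smooth_on_const smooth_on_dirder assms)
  then show ?thesis
    by (rule iffD1[OF smooth_on_cong[OF assms(1)], rotated])
       (simp add: linear_in_coordinates smooth_on_linear_dirder[OF assms(3)])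
qed

lemma smooth_on_vf_bracket:
  assumes "open S" "smooth_on S X" "smooth_on S Y"
  shows "smooth_on S (vf_bracket X Y)"
proof -
  have "smooth_on S (\<lambda>x. dirder Y x (X x) + (- 1) *\<^sub>R dirder X x (Y x))"
    by (intro smooth_on_add smooth_on_scaleR smooth_on_dirder_field assms)
  then show ?thesis by (simp add: vf_bracket_def[abs_def])
qed

lemma second_dirder_linear:
  fixes Y :: "'e::euclidean_space \<Rightarrow> 'e"
  assumes "open S" "smooth_on S Y" "x \<in> S"
  shows "linear (\<lambda>v. dirder (\<lambda>y. dirder Y y v) x w)"
  unfolding dirder_symmetric[OF assms, of _ w]
  by (rule smooth_on_linear_dirder[OF smooth_on_dirder[OF assms(2)] assms(3)])

text \<open>Product rule for the derivative of \<open>Y\<close> in the direction of a field \<open>X\<close> that moves as well. Expanding \<open>X\<close> in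
coordinates reduces it to derivatives in fixed directions; symmetry of second derivatives is what
makes the coordinates recombine.\<close>

lemma dirder_field_has_derivative:
  fixes Y :: "'e::euclidean_space \<Rightarrow> 'e"
  assumes S: "open S" and Y: "smooth_on S Y" and "x \<in> S" and X: "(X has_derivative X') (at x)"
  shows "((\<lambda>x. dirder Y x (X x)) has_derivative
          (\<lambda>w. dirder (\<lambda>y. dirder Y y (X x)) x w + dirder Y x (X' w))) (at x)"
proof -
  have "((\<lambda>x. \<Sum>b\<in>Basis. (X x \<bullet> b) *\<^sub>R dirder Y x b) has_derivative
     (\<lambda>w. \<Sum>b\<in>Basis. (X x \<bullet> b) *\<^sub>R dirder (\<lambda>y. dirder Y y b) x w + (X' w \<bullet> b) *\<^sub>R dirder Y x b)) (at x)"
    by (intro has_derivative_sum has_derivative_scaleR has_derivative_inner_left X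
        smooth_on_imp_has_derivative[OF smooth_on_dirder[OF Y] \<open>x \<in> S\<close>])
  also have "(\<lambda>w. \<Sum>b\<in>Basis. (X x \<bullet> b) *\<^sub>R dirder (\<lambda>y. dirder Y y b) x w + (X' w \<bullet> b) *\<^sub>R dirder Y x b)
     = (\<lambda>w. dirder (\<lambda>y. dirder Y y (X x)) x w + dirder Y x (X' w))"
    using linear_in_coordinates[OF second_dirder_linear[OF S Y \<open>x \<in> S\<close>]]
      linear_in_coordinates[OF smooth_on_linear_dirder[OF Y \<open>x \<in> S\<close>]]
    by (simp add: sum.distrib)
  finally show ?thesis
    by (rule iffD1[OF has_derivative_cong_open[OF S _ \<open>x \<in> S\<close>], rotated])
       (rule linear_in_coordinates[OF smooth_on_linear_dirder[OF Y]])
qed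

lemma dirder_vf_bracket:
  fixes X Y :: "'e::euclidean_space \<Rightarrow> 'e"
  assumes S: "open S" "x \<in> S" and X: "smooth_on S X" and Y: "smooth_on S Y"
  shows "dirder (vf_bracket X Y) x w =
     dirder (\<lambda>y. dirder Y y (X x)) x w + dirder Y x (dirder X x w)
     - (dirder (\<lambda>y. dirder X y (Y x)) x w + dirder X x (dirder Y x w))"
proof -
  note d = smooth_on_imp_has_derivative[OF X S(2)] smooth_on_imp_has_derivative[OF Y S(2)]
  show ?thesis unfolding vf_bracket_def[abs_def]
    by (rule fun_cong[OF dirder_eq])
       (intro has_derivative_diff dirder_field_has_derivative[OF S(1) X S(2) d(2)]
         dirder_field_has_derivative[OF S(1) Y S(2) d(1)])
qed

lemma vf_bracket_jacobi:
  fixes X Y Z :: "'e::euclidean_space \<Rightarrow> 'e"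
  assumes S: "open S" "x \<in> S" and sm: "smooth_on S X" "smooth_on S Y" "smooth_on S Z"
  shows "vf_bracket (vf_bracket X Y) Z x = vf_bracket X (vf_bracket Y Z) x - vf_bracket Y (vf_bracket X Z) x"
proof -
  have sub: "dirder X x (a - b) = dirder X x a - dirder X x b"
            "dirder Y x (a - b) = dirder Y x a - dirder Y x b"
            "dirder Z x (a - b) = dirder Z x a - dirder Z x b" for a b
    using smooth_on_linear_dirder[OF _ S(2)] sm linear_diff by blast+
  have l: "vf_bracket P Q x = dirder Q x (P x) - dirder P x (Q x)" for P Q :: "'e \<Rightarrow> 'e"
    by (simp add: vf_bracket_def)
  show ?thesis
    unfolding l[of "vf_bracket X Y" Z] l[of X "vf_bracket Y Z"] l[of Y "vf_bracket X Z"]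
    by (simp add: dirder_vf_bracket[OF S] sm sub vf_bracket_def[of X Y x] vf_bracket_def[of Y Z x] vf_bracket_def[of X Z x]
        dirder_symmetric[OF S(1) sm(1) S(2), of "Z x"] dirder_symmetric[OF S(1) sm(2) S(2), of "Z x"]
        dirder_symmetric[OF S(1) sm(3) S(2), of "Y x"])
qed

lemma
  assumes S: "open S" "x \<in> S" and Y: "smooth_on S Y"
  shows vf_bracket_add_left: "smooth_on S X \<Longrightarrow> smooth_on S X' \<Longrightarrow>
      vf_bracket (\<lambda>x. X x + X' x) Y x = vf_bracket X Y x + vf_bracket X' Y x"
    and vf_bracket_scale_left: "smooth_on S X \<Longrightarrow> vf_bracket (\<lambda>x. r *\<^sub>R X x) Y x = r *\<^sub>R vf_bracket X Y x"
    and vf_bracket_zero_left: "vf_bracket (\<lambda>x. 0) Y x = 0"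
    and vf_bracket_cong_left: "(\<And>x. x \<in> S \<Longrightarrow> X x = X' x) \<Longrightarrow> vf_bracket X Y x = vf_bracket X' Y x"
proof -
  note linY = smooth_on_linear_dirder[OF Y S(2)]
  note d = smooth_on_imp_has_derivative[OF _ S(2)]
  show "vf_bracket (\<lambda>x. X x + X' x) Y x = vf_bracket X Y x + vf_bracket X' Y x" if "smooth_on S X" "smooth_on S X'"
    using dirder_eq[OF has_derivative_add[OF d[OF that(1)] d[OF that(2)]]]
    by (simp add: vf_bracket_def linear_add[OF linY])
  show "vf_bracket (\<lambda>x. r *\<^sub>R X x) Y x = r *\<^sub>R vf_bracket X Y x" if "smooth_on S X"
    using dirder_eq[OF has_derivative_scaleR_right[OF d[OF that]]]
    by (simp add: vf_bracket_def linear_scale[OF linY] scaleR_diff_right)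
  show "vf_bracket (\<lambda>x. 0) Y x = 0"
    using dirder_eq[OF has_derivative_const[of 0 "at x"]]
    by (simp add: vf_bracket_def linear_0[OF linY])
  show "vf_bracket X Y x = vf_bracket X' Y x" if "\<And>x. x \<in> S \<Longrightarrow> X x = X' x"
    using dirder_cong_open[OF S(1) that S(2)] that[OF S(2)] by (simp add: vf_bracket_def)
qed

text \<open>The coordinate form of \<open>lie_algebra\<close>. The rule \<open>cong\<close> is needed because local representatives of fields
have arbitrary values outside the image of the chart.\<close>

inductive_set field_algebra :: "'e::euclidean_space set \<Rightarrow> ('e \<Rightarrow> 'e) set \<Rightarrow> ('e \<Rightarrow> 'e) set"
  for S :: "'e set" and F :: "('e \<Rightarrow> 'e) set"
where
  generator: "X \<in> F \<Longrightarrow> X \<in> field_algebra S F"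
| zero: "(\<lambda>x. 0) \<in> field_algebra S F"
| add: "X \<in> field_algebra S F \<Longrightarrow> Y \<in> field_algebra S F \<Longrightarrow> (\<lambda>x. X x + Y x) \<in> field_algebra S F"
| scale: "X \<in> field_algebra S F \<Longrightarrow> (\<lambda>x. r *\<^sub>R X x) \<in> field_algebra S F"
| bracket: "X \<in> field_algebra S F \<Longrightarrow> Y \<in> field_algebra S F \<Longrightarrow> vf_bracket X Y \<in> field_algebra S F"
| cong: "X \<in> field_algebra S F \<Longrightarrow> (\<And>x. x \<in> S \<Longrightarrow> X x = Y x) \<Longrightarrow> Y \<in> field_algebra S F"

section \<open>Local flows\<close>

text \<open>The flows of the control fields as seen in one chart with image \<open>S\<close>: \<open>W u\<close> consists of the pairs
\<open>(t, x)\<close> for which the flow line that starts at \<open>x\<close> is inside the chart at time \<open>t\<close>; in between it may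
leave the chart. The group law is therefore only available for pairs in \<open>W u\<close>.\<close>

locale local_flows =
  fixes S :: "'e::euclidean_space set" and U :: "'u set"
    and f :: "'u \<Rightarrow> 'e \<Rightarrow> 'e"
    and W :: "'u \<Rightarrow> (real \<times> 'e) set"
    and \<psi> :: "'u \<Rightarrow> real \<times> 'e \<Rightarrow> 'e"
  assumes open_S: "open S"
    and open_W: "u \<in> U \<Longrightarrow> open (W u)"
    and W_into: "u \<in> U \<Longrightarrow> p \<in> W u \<Longrightarrow> snd p \<in> S \<and> \<psi> u p \<in> S"
    and W_zero: "u \<in> U \<Longrightarrow> x \<in> S \<Longrightarrow> (0, x) \<in> W u"
    and psi_zero: "u \<in> U \<Longrightarrow> x \<in> S \<Longrightarrow> \<psi> u (0, x) = x"
    and W_add: "u \<in> U \<Longrightarrow> (t, x) \<in> W u \<Longrightarrow> (s, \<psi> u (t, x)) \<in> W u \<longleftrightarrow> (s + t, x) \<in> W u"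
    and psi_add: "u \<in> U \<Longrightarrow> (t, x) \<in> W u \<Longrightarrow> (s + t, x) \<in> W u \<Longrightarrow> \<psi> u (s, \<psi> u (t, x)) = \<psi> u (s + t, x)"
    and smooth_psi: "u \<in> U \<Longrightarrow> smooth_on (W u) (\<psi> u)"
    and smooth_f: "u \<in> U \<Longrightarrow> smooth_on S (f u)"
    and psi_velocity: "u \<in> U \<Longrightarrow> p \<in> W u \<Longrightarrow> dirder (\<psi> u) p (1, 0) = f u (\<psi> u p)"
begin

definition space_der :: "'u \<Rightarrow> real \<Rightarrow> 'e \<Rightarrow> 'e \<Rightarrow> 'e"
  where "space_der u t x h = dirder (\<psi> u) (t, x) (0, h)"

lemma psi_has_derivative:
  "u \<in> U \<Longrightarrow> p \<in> W u \<Longrightarrow> (\<psi> u has_derivative dirder (\<psi> u) p) (at p)"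
  by (rule smooth_on_imp_has_derivative[OF smooth_psi])

lemma linear_space_der: "u \<in> U \<Longrightarrow> (t, x) \<in> W u \<Longrightarrow> linear (space_der u t x)"
proof -
  assume a: "u \<in> U" "(t, x) \<in> W u"
  have "linear (dirder (\<psi> u) (t, x) \<circ> (\<lambda>h. (0, h)))"
    by (rule linear_compose[OF _ smooth_on_linear_dirder[OF smooth_psi a(2)]]) (auto simp: a intro: linearI)
  then show ?thesis by (simp add: space_der_def[abs_def] o_def)
qed

lemma dirder_psi:
  assumes "u \<in> U" "(t, x) \<in> W u"
  shows "dirder (\<psi> u) (t, x) (r, h) = r *\<^sub>R f u (\<psi> u (t, x)) + space_der u t x h"
proof -
  have lin: "linear (dirder (\<psi> u) (t, x))" using smooth_on_linear_dirder[OF smooth_psi] assms by blast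
  have "dirder (\<psi> u) (t, x) (r, h) = dirder (\<psi> u) (t, x) (r *\<^sub>R (1, 0) + (0, h))" by simp
  also have "\<dots> = r *\<^sub>R dirder (\<psi> u) (t, x) (1, 0) + dirder (\<psi> u) (t, x) (0, h)"
    by (simp only: linear_add[OF lin] linear_scale[OF lin])
  finally show ?thesis using psi_velocity[OF assms] by (simp add: space_der_def)
qed

lemma psi_compose_derivative:
  assumes u: "u \<in> U" and W: "(\<tau> y, g y) \<in> W u"
    and \<tau>: "(\<tau> has_derivative \<tau>') (at y)" and g: "(g has_derivative g') (at y)"
  shows "((\<lambda>y. \<psi> u (\<tau> y, g y)) has_derivative
    (\<lambda>h. \<tau>' h *\<^sub>R f u (\<psi> u (\<tau> y, g y)) + space_der u (\<tau> y) (g y) (g' h))) (at y)"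
  using has_derivative_compose[OF has_derivative_Pair[OF \<tau> g] psi_has_derivative[OF u W]]
  by (simp add: dirder_psi[OF u W])

lemma orbit_derivative:
  assumes u: "u \<in> U" and W: "(t, x) \<in> W u"
  shows "((\<lambda>t. \<psi> u (t, x)) has_derivative (\<lambda>h. h *\<^sub>R f u (\<psi> u (t, x)))) (at t)"
proof -
  have "((\<lambda>s. \<psi> u (s, x)) has_derivative (\<lambda>h. h *\<^sub>R f u (\<psi> u (t, x)) + space_der u t x 0)) (at t)"
    by (rule psi_compose_derivative[OF u]) (use W in auto)
  then show ?thesis using linear_0[OF linear_space_der[OF u W]] by simp
qed

lemma W_back: "u \<in> U \<Longrightarrow> (t, x) \<in> W u \<Longrightarrow> (- t, \<psi> u (t, x)) \<in> W u"
  using W_add[of u t x "- t"] W_zero[of u x] W_into[of u "(t, x)"] by simp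

lemma psi_back: "u \<in> U \<Longrightarrow> (t, x) \<in> W u \<Longrightarrow> \<psi> u (- t, \<psi> u (t, x)) = x"
  using psi_add[of u t x "- t"] W_zero[of u x] psi_zero[of u x] W_into[of u "(t, x)"] by simp

lemma open_W_slice:
  assumes "u \<in> U"
  shows "open {x. (t, x) \<in> W u}" "open {t. (t, x) \<in> W u}"
proof -
  have "open (Pair t -` W u)" "open ((\<lambda>t. (t, x)) -` W u)"
    by (intro open_vimage open_W assms continuous_intros)+
  then show "open {x. (t, x) \<in> W u}" "open {t. (t, x) \<in> W u}" by (auto simp: vimage_def)
qed

lemma space_der_inverse:
  assumes u: "u \<in> U" and W: "(t, x) \<in> W u"
  shows "space_der u (- t) (\<psi> u (t, x)) (space_der u t x h) = h"
proof -
  have 1: "((\<lambda>y. \<psi> u (t, y)) has_derivative (\<lambda>h. 0 *\<^sub>R f u (\<psi> u (t, x)) + space_der u t x h)) (at x)"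
    by (rule psi_compose_derivative[OF u]) (use W in auto)
  have "((\<lambda>y. \<psi> u (- t, \<psi> u (t, y))) has_derivative
     (\<lambda>h. 0 *\<^sub>R f u (\<psi> u (- t, \<psi> u (t, x))) +
        space_der u (- t) (\<psi> u (t, x)) (0 *\<^sub>R f u (\<psi> u (t, x)) + space_der u t x h))) (at x)"
    by (rule psi_compose_derivative[OF u _ _ 1]) (use W_back[OF u W] in auto)
  moreover have "((\<lambda>y. \<psi> u (- t, \<psi> u (t, y))) has_derivative (\<lambda>h. h)) (at x)"
    by (subst has_derivative_cong_open[OF open_W_slice(1)[OF u, of t], where g="\<lambda>y. y"])
       (use W psi_back[OF u] in auto)
  ultimately have "(\<lambda>h. 0 *\<^sub>R f u (\<psi> u (- t, \<psi> u (t, x))) +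
        space_der u (- t) (\<psi> u (t, x)) (0 *\<^sub>R f u (\<psi> u (t, x)) + space_der u t x h)) = (\<lambda>h. h)"
    by (rule has_derivative_unique)
  from fun_cong[OF this, of h] show ?thesis by simp
qed

lemma space_der_zero:
  assumes u: "u \<in> U" and x: "x \<in> S"
  shows "space_der u 0 x h = h"
proof -
  have "((\<lambda>y. \<psi> u (0, y)) has_derivative (\<lambda>h. 0 *\<^sub>R f u (\<psi> u (0, x)) + space_der u 0 x h)) (at x)"
    by (rule psi_compose_derivative[OF u]) (use W_zero[OF u x] in auto)
  moreover have "((\<lambda>y. \<psi> u (0, y)) has_derivative (\<lambda>h. h)) (at x)"
    by (rule iffD1[OF has_derivative_cong_open[OF open_S _ x] has_derivative_ident])
       (simp add: psi_zero[OF u])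
  ultimately have "(\<lambda>h. 0 *\<^sub>R f u (\<psi> u (0, x)) + space_der u 0 x h) = (\<lambda>h. h)"
    by (rule has_derivative_unique)
  from fun_cong[OF this, of h] show ?thesis by simp
qed

lemma inj_space_der: "u \<in> U \<Longrightarrow> (t, x) \<in> W u \<Longrightarrow> inj (space_der u t x)"
  by (rule inj_on_inverseI[where g="space_der u (- t) (\<psi> u (t, x))"]) (rule space_der_inverse)

text \<open>A field is invariant under its own flow: differentiate \<open>\<psi>\<^sub>t \<circ> \<psi>\<^sub>s = \<psi>\<^sub>t\<^sub>+\<^sub>s\<close> at \<open>s = 0\<close>.\<close>

lemma space_der_field:
  assumes u: "u \<in> U" and W: "(t, x) \<in> W u"
  shows "space_der u t x (f u x) = f u (\<psi> u (t, x))"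
proof -
  have x: "x \<in> S" using W_into[OF u W] by simp
  have 0: "((\<lambda>s. \<psi> u (s, x)) has_derivative (\<lambda>h. h *\<^sub>R f u x)) (at 0)"
    using orbit_derivative[OF u W_zero[OF u x]] psi_zero[OF u x] by simp
  have "((\<lambda>s. \<psi> u (t, \<psi> u (s, x))) has_derivative (\<lambda>h. 0 *\<^sub>R f u (\<psi> u (t, \<psi> u (0, x))) +
       space_der u t (\<psi> u (0, x)) (h *\<^sub>R f u x))) (at 0)"
    by (rule psi_compose_derivative[OF u _ _ 0]) (use W psi_zero[OF u x] in auto)
  then have 1: "((\<lambda>s. \<psi> u (t, \<psi> u (s, x))) has_derivative (\<lambda>h. space_der u t x (h *\<^sub>R f u x))) (at 0)"
    using psi_zero[OF u x] by simp
  have "((\<lambda>s. \<psi> u (t + s, x)) has_derivative (\<lambda>h. h *\<^sub>R f u (\<psi> u (t + 0, x)) + space_der u (t + 0) x 0)) (at 0)"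
    by (rule psi_compose_derivative[OF u]) (use W in \<open>auto intro!: derivative_eq_intros\<close>)
  then have 2: "((\<lambda>s. \<psi> u (t + s, x)) has_derivative (\<lambda>h. h *\<^sub>R f u (\<psi> u (t, x)))) (at 0)"
    using linear_0[OF linear_space_der[OF u W]] by simp
  have op: "open ({s. (s, x) \<in> W u} \<inter> (\<lambda>s. t + s) -` {s. (s, x) \<in> W u})"
    by (intro open_Int open_vimage open_W_slice u continuous_intros)
  have "((\<lambda>s. \<psi> u (t, \<psi> u (s, x))) has_derivative (\<lambda>h. h *\<^sub>R f u (\<psi> u (t, x)))) (at 0)"
  proof (subst has_derivative_cong_open[OF op, where g="\<lambda>s. \<psi> u (t + s, x)"])
    fix s assume "s \<in> {s. (s, x) \<in> W u} \<inter> (\<lambda>s. t + s) -` {s. (s, x) \<in> W u}"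
    then show "\<psi> u (t, \<psi> u (s, x)) = \<psi> u (t + s, x)" by (intro psi_add u) auto
  qed (use 2 W W_zero[OF u x] in auto)
  from fun_cong[OF has_derivative_unique[OF this 1], of 1] show ?thesis by simp
qed

text \<open>The bracket is the derivative of the pullback of \<open>Y\<close> along the flow. At \<open>t = 0\<close> the spatial derivative of
the flow is the identity on all of \<open>S\<close>, so only its time derivative contributes, and symmetry of second
derivatives identifies that with the derivative of the field \<open>f u\<close>.\<close>

lemma pullback_derivative:
  assumes u: "u \<in> U" and x: "x \<in> S" and Y: "smooth_on S Y"
  shows "((\<lambda>t. space_der u (- t) (\<psi> u (t, x)) (Y (\<psi> u (t, x)))) has_vector_derivative vf_bracket (f u) Y x) (at 0)"
proof -
  note W0 = W_zero[OF u x] note p0 = psi_zero[OF u x]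
  have \<psi>': "((\<lambda>t. \<psi> u (t, x)) has_derivative (\<lambda>h. h *\<^sub>R f u x)) (at 0)"
    using orbit_derivative[OF u W0] p0 by simp
  have Y': "((\<lambda>t. Y (\<psi> u (t, x))) has_derivative (\<lambda>h. dirder Y x (h *\<^sub>R f u x))) (at 0)"
    by (rule has_derivative_compose[OF \<psi>']) (use p0 smooth_on_imp_has_derivative[OF Y x] in simp)
  \<comment> \<open>The pullback is expanded in coordinates of the moving vector; this is the derivative of the coefficient maps.\<close>
  have G': "((\<lambda>t. dirder (\<psi> u) (- t, \<psi> u (t, x)) (0, b)) has_derivative (\<lambda>h. h *\<^sub>R (- dirder (f u) x b))) (at 0)" for b
  proof -
    let ?G = "\<lambda>p. dirder (\<psi> u) p (0, b)"
    have smG: "smooth_on (W u) ?G" by (rule smooth_on_dirder[OF smooth_psi[OF u]])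
    have G: "(?G has_derivative dirder ?G (0, x)) (at (0, x))"
      by (rule smooth_on_imp_has_derivative[OF smG W0])
    have "dirder ?G (0, x) (1, 0) = dirder (\<lambda>p. dirder (\<psi> u) p (1, 0)) (0, x) (0, b)"
      by (rule dirder_symmetric[OF open_W[OF u] smooth_psi[OF u] W0])
    also have "dirder (\<lambda>p. dirder (\<psi> u) p (1, 0)) (0, x) = dirder (\<lambda>p. f u (\<psi> u p)) (0, x)"
      by (rule dirder_cong_open[OF open_W[OF u] _ W0]) (rule psi_velocity[OF u])
    also have "dirder (\<lambda>p. f u (\<psi> u p)) (0, x) = (\<lambda>h. dirder (f u) (\<psi> u (0,x)) (dirder (\<psi> u) (0, x) h))"
      by (rule dirder_eq, rule has_derivative_compose[OF psi_has_derivative[OF u W0]])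
         (use p0 smooth_on_imp_has_derivative[OF smooth_f[OF u] x] in simp)
    also have "(\<dots>) (0, b) = dirder (f u) x (space_der u 0 x b)" by (simp add: p0 space_der_def)
    also have "space_der u 0 x b = b" by (rule space_der_zero[OF u x])
    finally have time: "dirder ?G (0, x) (1, 0) = dirder (f u) x b" .
    have space: "dirder ?G (0, x) (0, k) = 0" for k
    proof -
      have "((\<lambda>y. ?G (0, y)) has_derivative (\<lambda>k. dirder ?G (0, x) (0, k))) (at x)"
        by (rule has_derivative_compose[where f="\<lambda>y. (0, y)", OF _ G]) (auto intro!: derivative_eq_intros)
      moreover have "((\<lambda>y. ?G (0, y)) has_derivative (\<lambda>k. 0)) (at x)"
      proof (subst has_derivative_cong_open[OF open_S _ x, where g="\<lambda>_. b"])
        fix y assume "y \<in> S"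
        then show "?G (0, y) = b" using space_der_zero[OF u, of y b] by (simp add: space_der_def)
      qed simp
      ultimately have "(\<lambda>k. dirder ?G (0, x) (0, k)) = (\<lambda>k. 0)" by (rule has_derivative_unique)
      from fun_cong[OF this, of k] show ?thesis by simp
    qed
    have lin: "linear (dirder ?G (0, x))" using has_derivative_linear[OF G] .
    have "((\<lambda>t. (- t, \<psi> u (t, x))) has_derivative (\<lambda>h. (- h, h *\<^sub>R f u x))) (at 0)"
      by (intro has_derivative_Pair \<psi>') (auto intro!: derivative_eq_intros)
    from has_derivative_compose[OF this, of ?G "dirder ?G (0, x)"]
    have "((\<lambda>t. ?G (- t, \<psi> u (t, x))) has_derivative (\<lambda>h. dirder ?G (0, x) (- h, h *\<^sub>R f u x))) (at 0)"
      using G p0 by simp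
    moreover have "dirder ?G (0, x) (- h, h *\<^sub>R f u x) = h *\<^sub>R (- dirder (f u) x b)" for h
    proof -
      have "dirder ?G (0, x) (- h, h *\<^sub>R f u x) = dirder ?G (0, x) ((- h) *\<^sub>R (1, 0) + (0, h *\<^sub>R f u x))" by simp
      also have "\<dots> = (- h) *\<^sub>R dirder ?G (0, x) (1, 0) + dirder ?G (0, x) (0, h *\<^sub>R f u x)"
        by (simp only: linear_add[OF lin] linear_scale[OF lin])
      finally show ?thesis by (simp add: time space)
    qed
    ultimately show ?thesis by simp
  qed
  have coord: "space_der u (- t) (\<psi> u (t, x)) (Y (\<psi> u (t, x))) =
      (\<Sum>b\<in>Basis. (Y (\<psi> u (t, x)) \<bullet> b) *\<^sub>R dirder (\<psi> u) (- t, \<psi> u (t, x)) (0, b))"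
    if "t \<in> {t. (t, x) \<in> W u}" for t
    using linear_in_coordinates[OF linear_space_der[OF u W_back[OF u]]] that
    by (simp add: space_der_def)
  have G0: "dirder (\<psi> u) (0, x) (0, b) = b" for b
    using space_der_zero[OF u x, of b] by (simp add: space_der_def)
  have "((\<lambda>t. \<Sum>b\<in>Basis. (Y (\<psi> u (t, x)) \<bullet> b) *\<^sub>R dirder (\<psi> u) (- t, \<psi> u (t, x)) (0, b)) has_derivative
     (\<lambda>h. \<Sum>b\<in>Basis. (Y (\<psi> u (0, x)) \<bullet> b) *\<^sub>R (h *\<^sub>R (- dirder (f u) x b)) +
        (dirder Y x (h *\<^sub>R f u x) \<bullet> b) *\<^sub>R dirder (\<psi> u) (- 0, \<psi> u (0, x)) (0, b))) (at 0)"
    by (intro has_derivative_sum has_derivative_scaleR has_derivative_inner_left Y' G')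
  also have "(\<lambda>h. \<Sum>b\<in>Basis. (Y (\<psi> u (0, x)) \<bullet> b) *\<^sub>R (h *\<^sub>R (- dirder (f u) x b)) +
        (dirder Y x (h *\<^sub>R f u x) \<bullet> b) *\<^sub>R dirder (\<psi> u) (- 0, \<psi> u (0, x)) (0, b)) = (\<lambda>h. h *\<^sub>R vf_bracket (f u) Y x)"
  proof
    fix h
    have "(\<Sum>b\<in>Basis. (Y x \<bullet> b) *\<^sub>R (h *\<^sub>R (- dirder (f u) x b))) = - h *\<^sub>R (\<Sum>b\<in>Basis. (Y x \<bullet> b) *\<^sub>R dirder (f u) x b)"
      by (simp add: scaleR_sum_right sum_negf mult.commute)
    also have "\<dots> = - h *\<^sub>R dirder (f u) x (Y x)"
      by (simp add: linear_in_coordinates[OF smooth_on_linear_dirder[OF smooth_f[OF u] x]])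
    finally have f_part: "(\<Sum>b\<in>Basis. (Y x \<bullet> b) *\<^sub>R (h *\<^sub>R (- dirder (f u) x b))) = - h *\<^sub>R dirder (f u) x (Y x)" .
    have Y_part: "(\<Sum>b\<in>Basis. (dirder Y x (h *\<^sub>R f u x) \<bullet> b) *\<^sub>R dirder (\<psi> u) (- 0, \<psi> u (0, x)) (0, b))
        = h *\<^sub>R dirder Y x (f u x)"
      by (simp only: minus_zero p0 G0 euclidean_representation linear_scale[OF smooth_on_linear_dirder[OF Y x]])
    show "(\<Sum>b\<in>Basis. (Y (\<psi> u (0, x)) \<bullet> b) *\<^sub>R (h *\<^sub>R (- dirder (f u) x b)) +
        (dirder Y x (h *\<^sub>R f u x) \<bullet> b) *\<^sub>R dirder (\<psi> u) (- 0, \<psi> u (0, x)) (0, b)) = h *\<^sub>R vf_bracket (f u) Y x"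
      unfolding sum.distrib Y_part unfolding p0 f_part vf_bracket_def by (simp add: scaleR_diff_right)
  qed
  finally show ?thesis
    unfolding has_vector_derivative_def
    by (subst has_derivative_cong_open[OF open_W_slice(2)[OF u, of x] coord]) (use W0 in auto)
qed

end

section \<open>Krener's theorem in a chart\<close>

text \<open>The sign of \<open>\<sigma>\<close> selects whether \<open>E\<close> is invariant in positive or in negative time; both cases are needed,
and the arguments are the same.\<close>

locale semi_invariant_set = local_flows S U f W \<psi>
  for S :: "'e::euclidean_space set" and U :: "'u set"
    and f :: "'u \<Rightarrow> 'e \<Rightarrow> 'e" and W :: "'u \<Rightarrow> (real \<times> 'e) set"
    and \<psi> :: "'u \<Rightarrow> real \<times> 'e \<Rightarrow> 'e" +
  fixes \<sigma> :: real and E :: "'e set"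
  assumes sigma: "\<sigma> \<noteq> 0"
    and E_sub: "E \<subseteq> S"
    and E_inv: "u \<in> U \<Longrightarrow> x \<in> E \<Longrightarrow> (t, x) \<in> W u \<Longrightarrow> 0 < \<sigma> * t \<Longrightarrow> \<psi> u (t, x) \<in> E"
begin

text \<open>A first order jet of a family of points of \<open>E\<close>. The parameters of all families range over the model
space itself, whatever the number of flows used to build them; families with fewer effective
parameters have a derivative with a kernel.\<close>

definition reach_jet :: "'e \<Rightarrow> ('e \<Rightarrow> 'e) \<Rightarrow> bool"
  where "reach_jet x A \<longleftrightarrow> (\<exists>g N. open N \<and> 0 \<in> N \<and> continuous_on N g \<and> g ` N \<subseteq> E \<and>
           g 0 = x \<and> (g has_derivative A) (at 0))"

definition maximal_jet :: "'e \<Rightarrow> ('e \<Rightarrow> 'e) \<Rightarrow> bool"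
  where "maximal_jet x A \<longleftrightarrow> reach_jet x A \<and> (\<forall>y C. reach_jet y C \<longrightarrow> dim (range C) \<le> dim (range A))"

lemma reach_jet_linear: "reach_jet x A \<Longrightarrow> linear A"
  unfolding reach_jet_def using has_derivative_linear by blast

lemma reach_jet_in_S: "reach_jet x A \<Longrightarrow> x \<in> S"
  unfolding reach_jet_def using E_sub by blast

lemma reach_jet_const: "x \<in> E \<Longrightarrow> reach_jet x (\<lambda>h. 0)"
  unfolding reach_jet_def by (intro exI[of _ "\<lambda>_. x"] exI[of _ UNIV]) auto

text \<open>One more flow is followed, for the time \<open>t + l \<bullet> y\<close> that depends linearly on the parameter \<open>y\<close>; since
\<open>t\<close> is not \<open>0\<close>, this time keeps its sign near \<open>y = 0\<close>.\<close>

lemma reach_jet_extend: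
  assumes u: "u \<in> U" and R: "reach_jet x A" and W: "(t, x) \<in> W u" and t: "0 < \<sigma> * t"
  shows "reach_jet (\<psi> u (t, x)) (\<lambda>h. (l \<bullet> h) *\<^sub>R f u (\<psi> u (t, x)) + space_der u t x (A h))"
proof -
  obtain g N where g: "open N" "0 \<in> N" "continuous_on N g" "g ` N \<subseteq> E" "g 0 = x"
      "(g has_derivative A) (at 0)"
    using R unfolding reach_jet_def by blast
  let ?\<tau> = "\<lambda>y. t + l \<bullet> y" and ?h = "\<lambda>y. (t + l \<bullet> y, g y)"
  let ?N = "(N \<inter> ?h -` W u) \<inter> (\<lambda>y. \<sigma> * (t + l \<bullet> y)) -` {0<..}"
  have ch: "continuous_on N ?h" by (intro continuous_intros g)
  have "open (N \<inter> ?h -` W u)"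
    using continuous_on_open_vimage[OF g(1)] ch open_W[OF u] by (metis Int_commute)
  moreover have "open ((\<lambda>y. \<sigma> * (t + l \<bullet> y)) -` {0<..})"
    by (intro open_vimage open_greaterThan continuous_intros)
  ultimately have "open ?N" by (rule open_Int)
  moreover have "0 \<in> ?N" using g W t by auto
  moreover have "continuous_on ?N (\<lambda>y. \<psi> u (?h y))"
    by (rule continuous_on_compose2[OF smooth_on_imp_continuous_on[OF smooth_psi[OF u]]])
       (use ch in \<open>auto intro: continuous_on_subset\<close>)
  moreover have "(\<lambda>y. \<psi> u (?h y)) ` ?N \<subseteq> E"
    using E_inv[OF u] g(4) by blast
  moreover have "((\<lambda>y. \<psi> u (?h y)) has_derivative
     (\<lambda>h. (l \<bullet> h) *\<^sub>R f u (\<psi> u (?\<tau> 0, g 0)) + space_der u (?\<tau> 0) (g 0) (A h))) (at 0)"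
    by (rule psi_compose_derivative[OF u _ _ g(6)])
       (use W g in \<open>auto intro!: derivative_eq_intros\<close>)
  ultimately show ?thesis
    unfolding reach_jet_def using g(5)
    by (intro exI[of _ "\<lambda>y. \<psi> u (?h y)"] exI[of _ ?N]) simp
qed

lemma maximal_jet_exists:
  assumes "E \<noteq> {}"
  obtains x A where "maximal_jet x A"
proof -
  obtain x where "x \<in> E" using assms by blast
  then have P: "(\<lambda>p. reach_jet (fst p) (snd p)) (x, \<lambda>h. 0)" using reach_jet_const by simp
  have "\<exists>p. reach_jet (fst p) (snd p) \<and>
      (\<forall>q. reach_jet (fst q) (snd q) \<longrightarrow> dim (range (snd q)) \<le> dim (range (snd p)))"
    by (rule ex_has_greatest_nat[where P="\<lambda>p. reach_jet (fst p) (snd p)" and f="\<lambda>p. dim (range (snd p))"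
          and b="Suc DIM('e)", OF P]) (simp add: dim_subset_UNIV le_imp_less_Suc)
  then show ?thesis using that unfolding maximal_jet_def by force
qed

lemma maximal_jet_transport:
  assumes u: "u \<in> U" and R: "maximal_jet x A" and W: "(t, x) \<in> W u" and t: "0 < \<sigma> * t"
  shows "maximal_jet (\<psi> u (t, x)) (\<lambda>h. space_der u t x (A h))"
proof -
  have "reach_jet (\<psi> u (t, x)) (\<lambda>h. space_der u t x (A h))"
    using reach_jet_extend[OF u _ W t, of A 0] R by (simp add: maximal_jet_def)
  moreover have "dim (range (\<lambda>h. space_der u t x (A h))) = dim (range A)"
    using dim_image_eq[OF linear_space_der[OF u W], of "range A"] inj_space_der[OF u W]
    by (simp add: image_image inj_on_subset)
  ultimately show ?thesis using R by (simp add: maximal_jet_def)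
qed

lemma small_times:
  assumes "u \<in> U" "x \<in> S"
  shows "\<forall>\<^sub>F s in at_right 0. (\<sigma> * s, x) \<in> W u"
proof -
  have "open ((\<lambda>s. (\<sigma> * s, x)) -` W u)"
    by (intro open_vimage open_W assms continuous_intros)
  then have "\<forall>\<^sub>F s in nhds 0. s \<in> (\<lambda>s. (\<sigma> * s, x)) -` W u"
    by (rule eventually_nhds_in_open) (use W_zero[OF assms] in auto)
  then show ?thesis by (simp add: eventually_at_filter eventually_mono)
qed

text \<open>If \<open>f u x\<close> were not in the range of \<open>A\<close>, then \<open>A\<close> would have a kernel vector \<open>l\<close>, a parameter that is
still free. Using it for the flow time adds \<open>f u x\<close> to the range, up to the isomorphism \<open>space_der u t x\<close>,
against maximality.\<close>

lemma field_in_range: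
  assumes u: "u \<in> U" and R: "maximal_jet x A"
  shows "f u x \<in> range A"
proof (rule ccontr)
  assume nin: "f u x \<notin> range A"
  have R': "reach_jet x A" using R by (simp add: maximal_jet_def)
  note A = reach_jet_linear[OF R'] and x = reach_jet_in_S[OF R']
  have "\<not> inj A" using linear_injective_imp_surjective[OF A] nin by auto
  then obtain l where l: "l \<noteq> 0" "A l = 0" using linear_injective_0[OF A] by auto
  obtain s where s: "0 < s" "(\<sigma> * s, x) \<in> W u"
    using eventually_happens[OF eventually_conj[OF small_times[OF u x] eventually_at_right_less]] by auto
  define t where "t = \<sigma> * s"
  have W: "(t, x) \<in> W u" and t: "0 < \<sigma> * t" using s sigma by (auto simp: t_def zero_less_mult_iff mult_less_0_iff linorder_neq_iff)
  let ?B = "space_der u t x" and ?w = "f u (\<psi> u (t, x))"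
  let ?C = "\<lambda>h. (l \<bullet> h) *\<^sub>R ?w + ?B (A h)"
  note B = linear_space_der[OF u W]
  have "?B ` insert (f u x) (range A) \<subseteq> range ?C"
  proof
    fix z assume "z \<in> ?B ` insert (f u x) (range A)"
    then consider "z = ?B (f u x)" | h where "z = ?B (A h)" by auto
    then show "z \<in> range ?C"
    proof cases
      case 1
      have "?C ((1 / (l \<bullet> l)) *\<^sub>R l) = ?B (f u x)"
        using l by (simp add: linear_scale[OF A] linear_0[OF B] space_der_field[OF u W])
      then show ?thesis unfolding 1 by (rule range_eqI[OF sym])
    next
      case 2
      have "?C (h - ((l \<bullet> h) / (l \<bullet> l)) *\<^sub>R l) = ?B (A h)"
        using l by (simp add: linear_scale[OF A] linear_diff[OF A] inner_diff_right)
      then show ?thesis unfolding 2 by (rule range_eqI[OF sym])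
    qed
  qed
  then have "dim (?B ` insert (f u x) (range A)) \<le> dim (range ?C)"
    by (rule dim_subset)
  moreover have "dim (?B ` insert (f u x) (range A)) = dim (insert (f u x) (range A))"
    by (rule dim_image_eq[OF B]) (rule inj_on_subset[OF inj_space_der[OF u W]], simp)
  moreover have "span (range A) = range A"
    by (rule span_eq_iff[THEN iffD2], rule linear_subspace_image[OF A subspace_UNIV])
  with nin have "f u x \<notin> span (range A)" by metis
  then have "dim (insert (f u x) (range A)) = dim (range A) + 1"
    by (simp add: dim_insert)
  moreover have "dim (range ?C) \<le> dim (range A)"
    using R reach_jet_extend[OF u R' W t] unfolding maximal_jet_def by blast
  ultimately show False by simp
qed

text \<open>Fields tangent to all families of maximal rank. That this set is closed under all brackets cannot be
seen directly, because only the control fields come with flows that preserve \<open>E\<close>.\<close>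

definition tangent_fields :: "('e \<Rightarrow> 'e) set"
  where "tangent_fields = {Y. smooth_on S Y \<and> (\<forall>x A. maximal_jet x A \<longrightarrow> Y x \<in> range A)}"

text \<open>The flow of \<open>f u\<close> transports maximal jets, so the pullback of \<open>Y\<close> at \<open>x\<close> stays in the fixed closed subspace
\<open>range A\<close> for small times of the right sign; so does its one-sided derivative.\<close>

lemma tangent_fields_bracket:
  assumes u: "u \<in> U" and Y: "Y \<in> tangent_fields"
  shows "vf_bracket (f u) Y \<in> tangent_fields"
proof -
  have smY: "smooth_on S Y" using Y by (simp add: tangent_fields_def)
  have "vf_bracket (f u) Y x \<in> range A" if R: "maximal_jet x A" for x A
  proof -
    have R': "reach_jet x A" using R by (simp add: maximal_jet_def)
    note A = reach_jet_linear[OF R'] and x = reach_jet_in_S[OF R']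
    have sub: "subspace (range A)" by (rule linear_subspace_image[OF A subspace_UNIV])
    define F where "F t = space_der u (- t) (\<psi> u (t, x)) (Y (\<psi> u (t, x)))" for t
    have F0: "F 0 = Y x"
      unfolding F_def using psi_zero[OF u x] space_der_zero[OF u x] by simp
    have F_in: "F (\<sigma> * s) \<in> range A" if "0 < s" "(\<sigma> * s, x) \<in> W u" for s
    proof -
      have "0 < \<sigma> * (\<sigma> * s)" using that sigma by (auto simp: zero_less_mult_iff mult_less_0_iff linorder_neq_iff)
      from maximal_jet_transport[OF u R that(2) this]
      obtain h where "Y (\<psi> u (\<sigma> * s, x)) = space_der u (\<sigma> * s) x (A h)"
        using Y unfolding tangent_fields_def by blast
      then have "F (\<sigma> * s) = A h"
        unfolding F_def using space_der_inverse[OF u that(2)] by simp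
      then show ?thesis by simp
    qed
    have "(F has_vector_derivative vf_bracket (f u) Y x) (at 0)"
      unfolding F_def[abs_def] by (rule pullback_derivative[OF u x smY])
    then have F': "(F has_vector_derivative vf_bracket (f u) Y x) (at (\<sigma> * 0) within T)" for T
      by (simp add: has_vector_derivative_at_within)
    have "((\<lambda>s. \<sigma> * s) has_vector_derivative \<sigma>) (at 0 within {0<..})"
      by (auto intro!: derivative_eq_intros)
    from vector_diff_chain_within[OF this F']
    have "((\<lambda>s. F (\<sigma> * s)) has_vector_derivative \<sigma> *\<^sub>R vf_bracket (f u) Y x) (at 0 within {0<..})"
      by (simp add: o_def)
    from tendsto_difference_quotient[OF this]
    have lim: "((\<lambda>s. (1 / s) *\<^sub>R (F (\<sigma> * s) - F 0)) \<longlongrightarrow> \<sigma> *\<^sub>R vf_bracket (f u) Y x) (at_right 0)"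
      by simp
    have "\<sigma> *\<^sub>R vf_bracket (f u) Y x \<in> range A"
    proof (rule Lim_in_closed_set[OF closed_subspace[OF sub] _ _ lim])
      show "\<forall>\<^sub>F s in at_right 0. (1 / s) *\<^sub>R (F (\<sigma> * s) - F 0) \<in> range A"
        using small_times[OF u x] eventually_at_right_less[of 0]
      proof eventually_elim
        case (elim s)
        have "F 0 \<in> range A" using Y R unfolding F0 tangent_fields_def by blast
        with F_in elim show ?case by (intro subspace_scale[OF sub] subspace_diff[OF sub]) auto
      qed
    qed simp
    then have "(1 / \<sigma>) *\<^sub>R (\<sigma> *\<^sub>R vf_bracket (f u) Y x) \<in> range A" by (rule subspace_scale[OF sub])
    then show ?thesis using sigma by simp
  qed
  then show ?thesis
    unfolding tangent_fields_def using smooth_on_vf_bracket[OF open_S smooth_f[OF u] smY] by blast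
qed

lemma maximal_jet_subspace: "maximal_jet x A \<Longrightarrow> subspace (range A)"
  using linear_subspace_image[OF _ subspace_UNIV] reach_jet_linear by (auto simp: maximal_jet_def)

lemma tangent_fieldsI:
  "smooth_on S Y \<Longrightarrow> (\<And>x A. maximal_jet x A \<Longrightarrow> Y x \<in> range A) \<Longrightarrow> Y \<in> tangent_fields"
  by (simp add: tangent_fields_def)

lemma tangent_fieldsD:
  assumes "Y \<in> tangent_fields"
  shows "smooth_on S Y" "maximal_jet x A \<Longrightarrow> Y x \<in> range A"
  using assms unfolding tangent_fields_def by blast+

lemma tangent_fields_zero: "(\<lambda>x. 0) \<in> tangent_fields"
  by (intro tangent_fieldsI smooth_on_const subspace_0 maximal_jet_subspace)

lemma tangent_fields_add:
  "X \<in> tangent_fields \<Longrightarrow> Y \<in> tangent_fields \<Longrightarrow> (\<lambda>x. X x + Y x) \<in> tangent_fields"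
  by (intro tangent_fieldsI smooth_on_add open_S) (auto dest: tangent_fieldsD intro: subspace_add maximal_jet_subspace)

lemma tangent_fields_scale: "X \<in> tangent_fields \<Longrightarrow> (\<lambda>x. r *\<^sub>R X x) \<in> tangent_fields"
  by (intro tangent_fieldsI smooth_on_scaleR open_S) (auto dest: tangent_fieldsD intro: subspace_scale maximal_jet_subspace)

lemma tangent_fields_cong:
  assumes "X \<in> tangent_fields" "\<And>x. x \<in> S \<Longrightarrow> X x = Y x"
  shows "Y \<in> tangent_fields"
proof -
  have "Y x = X x" if "maximal_jet x A" for x A
    using assms(2)[OF reach_jet_in_S] that by (auto simp: maximal_jet_def)
  then show ?thesis
    using assms smooth_on_cong[OF open_S assms(2)] by (simp add: tangent_fields_def)
qed

text \<open>Unlike \<open>tangent_fields\<close>, the normalizer is closed under brackets by the Jacobi identity alone.\<close>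

definition field_normalizer :: "('e \<Rightarrow> 'e) set"
  where "field_normalizer = {X \<in> tangent_fields. \<forall>Y\<in>tangent_fields. vf_bracket X Y \<in> tangent_fields}"

lemma field_normalizerI:
  assumes "X \<in> tangent_fields"
    and "\<And>Y. Y \<in> tangent_fields \<Longrightarrow> smooth_on S Y \<Longrightarrow> \<exists>Z\<in>tangent_fields. \<forall>x\<in>S. Z x = vf_bracket X Y x"
  shows "X \<in> field_normalizer"
proof -
  have "vf_bracket X Y \<in> tangent_fields" if Y: "Y \<in> tangent_fields" for Y
  proof -
    have "smooth_on S Y" using Y by (simp add: tangent_fields_def)
    from assms(2)[OF Y this] obtain Z where "Z \<in> tangent_fields" "\<forall>x\<in>S. Z x = vf_bracket X Y x" ..
    then show ?thesis using tangent_fields_cong[of Z "vf_bracket X Y"] by blast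
  qed
  then show ?thesis using assms(1) by (simp add: field_normalizer_def)
qed

lemma field_normalizerD:
  assumes "X \<in> field_normalizer"
  shows "X \<in> tangent_fields" "smooth_on S X" "Y \<in> tangent_fields \<Longrightarrow> vf_bracket X Y \<in> tangent_fields"
  using assms unfolding field_normalizer_def tangent_fields_def by blast+

lemma field_algebra_normalizes:
  assumes "X \<in> field_algebra S (f ` U)"
  shows "X \<in> field_normalizer"
  using assms
proof (induction rule: field_algebra.induct)
  case (generator X)
  then show ?case
    using tangent_fields_bracket smooth_f field_in_range
    by (auto simp: field_normalizer_def tangent_fields_def)
next
  case zero
  show ?case
    by (intro field_normalizerI tangent_fields_zero bexI[OF _ tangent_fields_zero])
       (simp add: vf_bracket_zero_left[OF open_S])
next
  case (add X X')
  note X = field_normalizerD[OF add.IH(1)] and X' = field_normalizerD[OF add.IH(2)]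
  show ?case
  proof (rule field_normalizerI[OF tangent_fields_add[OF X(1) X'(1)]])
    fix Y assume Y: "Y \<in> tangent_fields" "smooth_on S Y"
    show "\<exists>Z\<in>tangent_fields. \<forall>x\<in>S. Z x = vf_bracket (\<lambda>x. X x + X' x) Y x"
      by (rule bexI[OF _ tangent_fields_add[OF X(3)[OF Y(1)] X'(3)[OF Y(1)]]])
         (simp add: vf_bracket_add_left[OF open_S _ Y(2) X(2) X'(2)])
  qed
next
  case (scale X r)
  note X = field_normalizerD[OF scale.IH]
  show ?case
  proof (rule field_normalizerI[OF tangent_fields_scale[OF X(1)]])
    fix Y assume Y: "Y \<in> tangent_fields" "smooth_on S Y"
    show "\<exists>Z\<in>tangent_fields. \<forall>x\<in>S. Z x = vf_bracket (\<lambda>x. r *\<^sub>R X x) Y x"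
      by (rule bexI[OF _ tangent_fields_scale[where r=r, OF X(3)[OF Y(1)]]])
         (simp add: vf_bracket_scale_left[OF open_S _ Y(2) X(2)])
  qed
next
  case (bracket X X')
  note X = field_normalizerD[OF bracket.IH(1)] and X' = field_normalizerD[OF bracket.IH(2)]
  show ?case
  proof (rule field_normalizerI[OF X(3)[OF X'(1)]])
    fix Y assume Y: "Y \<in> tangent_fields" "smooth_on S Y"
    have "(\<lambda>x. vf_bracket X (vf_bracket X' Y) x + (- 1) *\<^sub>R vf_bracket X' (vf_bracket X Y) x) \<in> tangent_fields"
      by (intro tangent_fields_add tangent_fields_scale X(3) X'(3) Y(1))
    then show "\<exists>Z\<in>tangent_fields. \<forall>x\<in>S. Z x = vf_bracket (vf_bracket X X') Y x"
      by (rule bexI[rotated]) (simp add: vf_bracket_jacobi[OF open_S _ X(2) X'(2) Y(2)])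
  qed
next
  case (cong X Y)
  note X = field_normalizerD[OF cong.IH]
  show ?case
  proof (rule field_normalizerI[OF tangent_fields_cong[OF X(1) cong.hyps(2)]])
    fix Z assume Z: "Z \<in> tangent_fields" "smooth_on S Z"
    show "\<exists>Z'\<in>tangent_fields. \<forall>x\<in>S. Z' x = vf_bracket Y Z x"
      by (intro bexI[OF _ X(3)[OF Z(1)]] ballI vf_bracket_cong_left[OF open_S _ Z(2) cong.hyps(2)])
  qed
qed

text \<open>A jet of maximal rank is onto, so the open mapping theorem for maps with surjective derivative at one
point applies to the family that realizes it.\<close>

lemma krener:
  assumes "E \<noteq> {}" and rank: "\<And>x v. x \<in> E \<Longrightarrow> \<exists>X\<in>field_algebra S (f ` U). X x = v"
  shows "interior E \<noteq> {}"
proof -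
  obtain x A where R: "maximal_jet x A" using maximal_jet_exists[OF assms(1)] .
  then obtain g N where g: "open N" "0 \<in> N" "continuous_on N g" "g ` N \<subseteq> E" "g 0 = x"
      "(g has_derivative A) (at 0)"
    unfolding maximal_jet_def reach_jet_def by blast
  have "x \<in> E" using g by blast
  have "v \<in> range A" for v
  proof -
    obtain X where "X \<in> field_algebra S (f ` U)" "X x = v" using rank[OF \<open>x \<in> E\<close>] by blast
    then show ?thesis
      using field_algebra_normalizes R unfolding field_normalizer_def tangent_fields_def by blast
  qed
  then have "surj A" by blast
  then obtain G where G: "linear G" "A \<circ> G = id"
    using linear_surjective_right_inverse[OF has_derivative_linear[OF g(6)]] by blast
  have "g 0 \<in> interior (g ` N)"
    by (rule sussmann_open_mapping[OF g(1,3,2,6) linear_conv_bounded_linear[THEN iffD1, OF G(1)] G(2) subset_refl])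
       (use g in \<open>simp add: interior_open\<close>)
  then show ?thesis using interior_mono[OF g(4)] by blast
qed

end

section \<open>Charts, flows and the rank condition on the manifold\<close>

context
  fixes \<A> :: "('a::topological_space, 'e::euclidean_space) chart set" and c
  assumes atlas: "smooth_atlas \<A>" and c: "c \<in> \<A>"
begin

lemma chart_facts:
  shows open_chart: "open (fst c)" and open_chart_img: "open (chart_img c)"
    and chart_homeo: "homeomorphism (fst c) (chart_img c) (snd c) (chart_inv c)"
  using atlas c unfolding smooth_atlas_def is_chart_def by blast+

lemma chart_inv_snd: "q \<in> fst c \<Longrightarrow> chart_inv c (snd c q) = q"
  using chart_homeo by (simp add: homeomorphism_def)

lemma snd_chart_inv: "x \<in> chart_img c \<Longrightarrow> snd c (chart_inv c x) = x"
  using chart_homeo by (simp add: homeomorphism_def)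

lemma chart_inv_in: "x \<in> chart_img c \<Longrightarrow> chart_inv c x \<in> fst c"
  using homeomorphism_image2[OF chart_homeo] by blast

lemma snd_in_img: "q \<in> fst c \<Longrightarrow> snd c q \<in> chart_img c"
  by (simp add: chart_img_def)

lemma continuous_on_chart: "continuous_on (fst c) (snd c)"
  using chart_homeo by (simp add: homeomorphism_def)

lemma continuous_on_chart_inv: "continuous_on (chart_img c) (chart_inv c)"
  using chart_homeo by (simp add: homeomorphism_def)

lemma open_chart_preimage: "open T \<Longrightarrow> open (fst c \<inter> snd c -` T)"
  using continuous_on_open_vimage[OF open_chart, THEN iffD1, OF continuous_on_chart]
  by (simp add: Int_commute)

lemma open_snd_image:
  assumes "open T" "T \<subseteq> fst c"
  shows "open (snd c ` T)"
proof -
  have "snd c ` T = chart_inv c -` T \<inter> chart_img c"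
  proof (intro set_eqI iffI)
    fix x assume "x \<in> snd c ` T"
    then show "x \<in> chart_inv c -` T \<inter> chart_img c"
      using assms(2) by (auto simp: chart_inv_snd snd_in_img)
  next
    fix x assume "x \<in> chart_inv c -` T \<inter> chart_img c"
    then show "x \<in> snd c ` T" by (intro image_eqI[of _ _ "chart_inv c x"]) (simp_all add: snd_chart_inv)
  qed
  moreover have "open (chart_inv c -` T \<inter> chart_img c)"
    using continuous_on_open_vimage[OF open_chart_img, THEN iffD1, OF continuous_on_chart_inv] assms(1)
    by blast
  ultimately show ?thesis by simp
qed

end

lemma transition_has_derivative:
  assumes "smooth_atlas \<A>" "c \<in> \<A>" "d \<in> \<A>" "q \<in> fst c" "q \<in> fst d"
  shows "(transition c d has_derivative dirder (transition c d) (snd c q)) (at (snd c q))"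
proof -
  have "smooth_on (snd c ` (fst c \<inter> fst d)) (transition c d)"
    using assms(1-3) by (simp add: smooth_atlas_def)
  moreover have "snd c q \<in> snd c ` (fst c \<inter> fst d)" using assms(4,5) by simp
  ultimately show ?thesis by (rule smooth_on_imp_has_derivative)
qed

lemma dirder_transition_compose:
  assumes A: "smooth_atlas \<A>" and "c \<in> \<A>" "d \<in> \<A>" "e \<in> \<A>"
    and q: "q \<in> fst c" "q \<in> fst d" "q \<in> fst e"
  shows "dirder (transition c e) (snd c q) v
       = dirder (transition d e) (snd d q) (dirder (transition c d) (snd c q) v)"
proof -
  let ?T = "snd c ` (fst c \<inter> fst d)"
  have op: "open ?T"
    by (rule open_snd_image[OF A \<open>c \<in> \<A>\<close> open_Int[OF open_chart[OF A \<open>c \<in> \<A>\<close>] open_chart[OF A \<open>d \<in> \<A>\<close>]]]) simp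
  have x: "snd c q \<in> ?T" using q by simp
  have tr: "transition c d (snd c q) = snd d q"
    using q by (simp add: transition_def chart_inv_snd[OF A \<open>c \<in> \<A>\<close>])
  have "((\<lambda>y. transition d e (transition c d y)) has_derivative
     (\<lambda>v. dirder (transition d e) (snd d q) (dirder (transition c d) (snd c q) v))) (at (snd c q))"
    by (rule has_derivative_compose[OF transition_has_derivative[OF A \<open>c \<in> \<A>\<close> \<open>d \<in> \<A>\<close> q(1,2)]])
       (use transition_has_derivative[OF A \<open>d \<in> \<A>\<close> \<open>e \<in> \<A>\<close> q(2,3)] tr in simp)
  then have "(transition c e has_derivative
     (\<lambda>v. dirder (transition d e) (snd d q) (dirder (transition c d) (snd c q) v))) (at (snd c q))"
  proof (rule iffD1[OF has_derivative_cong_open[OF op _ x], rotated])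
    fix y assume "y \<in> ?T"
    then show "transition d e (transition c d y) = transition c e y"
      by (auto simp: transition_def chart_inv_snd[OF A \<open>c \<in> \<A>\<close>] chart_inv_snd[OF A \<open>d \<in> \<A>\<close>])
  qed
  from dirder_eq[OF this] show ?thesis by simp
qed

text \<open>A single component in one chart determines a tangent vector, the chain rule for transition maps
giving the compatibility of the others.\<close>

lemma tangent_vector_with_component:
  assumes A: "smooth_atlas \<A>" and c: "c \<in> \<A>" and q: "q \<in> fst c"
  obtains w where "w \<in> tangent_space \<A> q" "w c = v"
proof
  define w where "w = (\<lambda>d. if d \<in> \<A> \<and> q \<in> fst d then dirder (transition c d) (snd c q) v else 0)"
  show "w \<in> tangent_space \<A> q"
    unfolding tangent_space_def
  proof (intro CollectI conjI allI impI ballI)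
    fix d assume "\<not> (d \<in> \<A> \<and> q \<in> fst d)"
    then show "w d = 0" unfolding w_def by (rule if_not_P)
  next
    fix d e assume "d \<in> \<A>" "e \<in> \<A>" "q \<in> fst d \<inter> fst e"
    then show "w e = dirder (transition d e) (snd d q) (w d)"
      using dirder_transition_compose[OF A c \<open>d \<in> \<A>\<close> \<open>e \<in> \<A>\<close> q, of v] by (simp add: w_def)
  qed
  have "(transition c c has_derivative (\<lambda>h. h)) (at (snd c q))"
    by (rule iffD2[OF has_derivative_cong_open[OF open_chart_img[OF A c] _ snd_in_img[OF A c q]] has_derivative_ident])
       (simp add: transition_def snd_chart_inv[OF A c])
  from dirder_eq[OF this] show "w c = v" using c q by (simp add: w_def)
qed

lemma lie_algebra_local_rep:
  assumes A: "smooth_atlas \<A>" and c: "c \<in> \<A>"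
    and "Y \<in> lie_algebra \<A> \<X>" and "\<X> \<subseteq> \<Y>"
  shows "local_rep Y c \<in> field_algebra (chart_img c) ((\<lambda>X. local_rep X c) ` \<Y>)"
  using assms(3)
proof (induction rule: lie_algebra.induct)
  case (generator X)
  then show ?case using assms(4) by (blast intro: field_algebra.generator)
next
  case zero
  then show ?case using field_algebra.zero by (simp add: local_rep_def)
next
  case (add X Y)
  from field_algebra.add[OF add.IH] show ?case by (simp add: local_rep_def)
next
  case (scale X r)
  from field_algebra.scale[OF scale.IH] show ?case by (simp add: local_rep_def scaleR_fun_def)
next
  case (bracket X Y)
  show ?case
  proof (rule field_algebra.cong[OF field_algebra.bracket[OF bracket.IH]])
    fix x assume x: "x \<in> chart_img c"
    then show "vf_bracket (local_rep X c) (local_rep Y c) x = local_rep (lie_bracket \<A> X Y) c x"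
      using chart_inv_in[OF A c x] c snd_chart_inv[OF A c x]
      by (simp add: vf_bracket_def local_rep_def[of "lie_bracket _ _ _"] lie_bracket_def)
         (simp add: local_rep_def)
  qed
qed

locale flow_system =
  fixes \<A> :: "('a::topological_space, 'e::euclidean_space) chart set"
    and U :: "'u set" and V :: "'u \<Rightarrow> ('a, 'e) vfield" and P :: "'u \<Rightarrow> real \<Rightarrow> 'a \<Rightarrow> 'a"
  assumes atlas: "smooth_atlas \<A>"
    and smooth_V: "u \<in> U \<Longrightarrow> smooth_vfield_on \<A> UNIV (V u)"
    and generates_P: "u \<in> U \<Longrightarrow> generates \<A> (V u) (P u)"
begin

lemma flow_zero: "u \<in> U \<Longrightarrow> P u 0 q = q"
  using generates_P by (simp add: generates_def one_parameter_group_def)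

lemma flow_add: "u \<in> U \<Longrightarrow> P u s (P u t q) = P u (s + t) q"
  using generates_P by (simp add: generates_def one_parameter_group_def)

lemma flow_continuous: "u \<in> U \<Longrightarrow> continuous_on UNIV (\<lambda>(t, q). P u t q)"
  using generates_P by (simp add: generates_def one_parameter_group_def)

lemma flow_velocity: "u \<in> U \<Longrightarrow> has_velocity \<A> (\<lambda>s. P u s q) (V u (P u t q)) t UNIV"
  using generates_P by (simp add: generates_def)

lemma flow_continuous_on [continuous_intros]:
  assumes "u \<in> U" "continuous_on T \<tau>" "continuous_on T g"
  shows "continuous_on T (\<lambda>x. P u (\<tau> x) (g x))"
  using continuous_on_compose2[OF flow_continuous[OF assms(1)] continuous_on_Pair[OF assms(2,3)]]
  by simp

lemma chart_at: obtains c where "c \<in> \<A>" "q \<in> fst c"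
  using atlas unfolding smooth_atlas_def by blast

lemma open_flow_preimage: "u \<in> U \<Longrightarrow> open T \<Longrightarrow> open (P u t -` T)"
  by (rule open_vimage) (auto intro: continuous_intros)

definition flow_dom :: "('a, 'e) chart \<Rightarrow> 'u \<Rightarrow> (real \<times> 'e) set"
  where "flow_dom c u = {(t, x). x \<in> chart_img c \<and> P u t (chart_inv c x) \<in> fst c}"

definition chart_flow :: "('a, 'e) chart \<Rightarrow> 'u \<Rightarrow> real \<times> 'e \<Rightarrow> 'e"
  where "chart_flow c u = (\<lambda>(t, x). snd c (P u t (chart_inv c x)))"

lemma smooth_local_rep: "c \<in> \<A> \<Longrightarrow> u \<in> U \<Longrightarrow> smooth_on (chart_img c) (local_rep (V u) c)"
  using smooth_V unfolding smooth_vfield_on_def by (simp add: chart_img_def)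

lemma local_rep_at: "c \<in> \<A> \<Longrightarrow> q \<in> fst c \<Longrightarrow> local_rep X c (snd c q) = X q c"
  by (simp add: local_rep_def chart_inv_snd[OF atlas])

lemma flow_chart_derivative:
  assumes "c \<in> \<A>" "u \<in> U" "P u t q \<in> fst c"
  shows "((\<lambda>s. snd c (P u s q)) has_vector_derivative local_rep (V u) c (snd c (P u t q))) (at t)"
  using flow_velocity[OF assms(2), of q t] assms(1,3) local_rep_at[OF assms(1,3)]
  by (simp add: has_velocity_def o_def)

text \<open>Brings the results for local flows to the manifold: every chart is an instance.\<close>

lemma local_flows_chart:
  assumes c: "c \<in> \<A>"
  shows "local_flows (chart_img c) U (\<lambda>u. local_rep (V u) c) (flow_dom c) (chart_flow c)"
proof
  note inv = chart_inv_snd[OF atlas c] and in_img = snd_in_img[OF atlas c]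
    and in_chart = chart_inv_in[OF atlas c] and inv' = snd_chart_inv[OF atlas c]
  show "open (chart_img c)" by (rule open_chart_img[OF atlas c])
  fix u assume u: "u \<in> U"
  show sm: "smooth_on (flow_dom c u) (chart_flow c u)"
    using generates_P[OF u] c
    by (simp add: generates_def one_parameter_group_def flow_dom_def chart_flow_def)
  show "smooth_on (chart_img c) (local_rep (V u) c)" by (rule smooth_local_rep[OF c u])
  show "open (flow_dom c u)"
  proof -
    have op: "open (UNIV \<times> chart_img c :: (real \<times> 'e) set)"
      by (intro open_Times open_UNIV open_chart_img[OF atlas c])
    have "continuous_on (UNIV \<times> chart_img c) (\<lambda>p. P u (fst p) (chart_inv c (snd p)))"
      by (intro continuous_intros u continuous_on_compose2[OF continuous_on_chart_inv[OF atlas c]]) auto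
    then have "open ((\<lambda>p. P u (fst p) (chart_inv c (snd p))) -` fst c \<inter> UNIV \<times> chart_img c)"
      using continuous_on_open_vimage[OF op] open_chart[OF atlas c] by blast
    also have "(\<lambda>p. P u (fst p) (chart_inv c (snd p))) -` fst c \<inter> UNIV \<times> chart_img c = flow_dom c u"
      by (auto simp: flow_dom_def)
    finally show ?thesis .
  qed
  show "snd p \<in> chart_img c \<and> chart_flow c u p \<in> chart_img c" if "p \<in> flow_dom c u" for p
    using that in_img by (auto simp: flow_dom_def chart_flow_def)
  show "(0, x) \<in> flow_dom c u" "chart_flow c u (0, x) = x" if "x \<in> chart_img c" for x
    using that in_chart inv' by (auto simp: flow_dom_def chart_flow_def flow_zero u)
  show "(s, chart_flow c u (t, x)) \<in> flow_dom c u \<longleftrightarrow> (s + t, x) \<in> flow_dom c u"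
    if "(t, x) \<in> flow_dom c u" for s t x
    using that by (auto simp: flow_dom_def chart_flow_def flow_add u inv in_img)
  show "chart_flow c u (s, chart_flow c u (t, x)) = chart_flow c u (s + t, x)"
    if "(t, x) \<in> flow_dom c u" for s t x
    using that by (auto simp: flow_dom_def chart_flow_def flow_add u inv)
  show "dirder (chart_flow c u) p (1, 0) = local_rep (V u) c (chart_flow c u p)"
    if p: "p \<in> flow_dom c u" for p
  proof -
    obtain t x where tx: "p = (t, x)" by fastforce
    have "((\<lambda>s. chart_flow c u (s, x)) has_derivative (\<lambda>h. dirder (chart_flow c u) (t, x) (h, 0))) (at t)"
      by (rule has_derivative_compose[where f="\<lambda>s. (s, x)", OF _ smooth_on_imp_has_derivative[OF sm]])
         (use p tx in \<open>auto intro!: derivative_eq_intros\<close>)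
    moreover have "((\<lambda>s. chart_flow c u (s, x)) has_derivative (\<lambda>h. h *\<^sub>R local_rep (V u) c (chart_flow c u (t, x)))) (at t)"
      using flow_chart_derivative[OF c u, of t "chart_inv c x"] p tx
      by (simp add: chart_flow_def flow_dom_def has_vector_derivative_def)
    ultimately have "(\<lambda>h. dirder (chart_flow c u) (t, x) (h, 0)) = (\<lambda>h. h *\<^sub>R local_rep (V u) c (chart_flow c u (t, x)))"
      by (rule has_derivative_unique)
    from fun_cong[OF this, of 1] show ?thesis by (simp add: tx)
  qed
qed

lemma LARC_field_algebra:
  assumes c: "c \<in> \<A>" and x: "x \<in> chart_img c" and L: "LARC_at \<A> U V (chart_inv c x)"
  shows "\<exists>X\<in>field_algebra (chart_img c) ((\<lambda>u. local_rep (V u) c) ` U). X x = v"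
proof -
  let ?q = "chart_inv c x"
  obtain w where w: "w \<in> tangent_space \<A> ?q" "w c = v"
    using tangent_vector_with_component[OF atlas c chart_inv_in[OF atlas c x]] .
  obtain F Y where F: "F \<subseteq> U" and Y: "Y \<in> lie_algebra \<A> (V ` F)" "w = Y ?q"
    using L w(1) unfolding LARC_at_def by blast
  have "local_rep Y c \<in> field_algebra (chart_img c) ((\<lambda>X. local_rep X c) ` V ` U)"
    by (rule lie_algebra_local_rep[OF atlas c Y(1)]) (use F in blast)
  moreover have "local_rep Y c x = v" using w(2) Y(2) by (simp add: local_rep_def)
  ultimately show ?thesis by (auto simp: image_image)
qed

lemma krener_manifold:
  assumes L: "\<And>q. LARC_at \<A> U V q" and "\<sigma> \<noteq> 0" and q: "q \<in> A"
    and inv: "\<And>u t p. u \<in> U \<Longrightarrow> p \<in> A \<Longrightarrow> 0 < \<sigma> * t \<Longrightarrow> P u t p \<in> A"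
  shows "interior A \<noteq> {}"
proof -
  \<comment> \<open>In the chart the set need only be invariant at times when the flow line is back in the chart.\<close>
  obtain c where c: "c \<in> \<A>" "q \<in> fst c" by (rule chart_at)
  let ?E = "{x \<in> chart_img c. chart_inv c x \<in> A}"
  interpret local_flows "chart_img c" U "\<lambda>u. local_rep (V u) c" "flow_dom c" "chart_flow c"
    by (rule local_flows_chart[OF c(1)])
  interpret semi_invariant_set "chart_img c" U "\<lambda>u. local_rep (V u) c" "flow_dom c" "chart_flow c" \<sigma> ?E
  proof
    show "chart_flow c u (t, x) \<in> ?E"
      if "u \<in> U" "x \<in> ?E" "(t, x) \<in> flow_dom c u" "0 < \<sigma> * t" for u x t
      using that inv
      by (simp add: flow_dom_def chart_flow_def snd_in_img[OF atlas c(1)] chart_inv_snd[OF atlas c(1)])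
  qed (use \<open>\<sigma> \<noteq> 0\<close> in auto)
  have "interior ?E \<noteq> {}"
  proof (rule krener)
    show "?E \<noteq> {}" using q c chart_inv_snd[OF atlas c] snd_in_img[OF atlas c] by force
    show "\<exists>X\<in>field_algebra (chart_img c) ((\<lambda>u. local_rep (V u) c) ` U). X x = v" if "x \<in> ?E" for x v
      using that LARC_field_algebra[OF c(1) _ L] by blast
  qed
  then obtain x where x: "x \<in> interior ?E" by blast
  let ?O = "fst c \<inter> snd c -` interior ?E"
  have x_img: "x \<in> chart_img c" using x interior_subset by blast
  have "open ?O" by (rule open_chart_preimage[OF atlas c(1) open_interior])
  moreover have "?O \<subseteq> A"
    using interior_subset[of ?E] chart_inv_snd[OF atlas c(1)] by fastforce
  moreover have "chart_inv c x \<in> ?O"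
    using x chart_inv_in[OF atlas c(1) x_img] snd_chart_inv[OF atlas c(1) x_img] by simp
  ultimately show ?thesis using interior_maximal by blast
qed

end

section \<open>Closed forward invariant sets are backward invariant\<close>

lemma smooth_locally_lipschitz:
  fixes g :: "'e::euclidean_space \<Rightarrow> 'b::real_normed_vector"
  assumes "open S" "smooth_on S g" "x \<in> S"
  obtains R L where "0 < R" "0 \<le> L" "cball x R \<subseteq> S"
    "\<And>a b. a \<in> cball x R \<Longrightarrow> b \<in> cball x R \<Longrightarrow> norm (g a - g b) \<le> L * norm (a - b)"
proof -
  obtain R where R: "0 < R" "cball x R \<subseteq> S" using assms(1,3) open_contains_cball by blast
  have "\<exists>M. \<forall>y\<in>cball x R. norm (dirder g y b) \<le> M" for b
  proof -
    have "continuous_on (cball x R) (\<lambda>y. dirder g y b)"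
      using smooth_on_imp_continuous_on[OF smooth_on_dirder[OF assms(2)]] R(2) by (rule continuous_on_subset)
    then have "bounded ((\<lambda>y. dirder g y b) ` cball x R)"
      by (intro compact_imp_bounded compact_continuous_image compact_cball)
    then show ?thesis unfolding bounded_iff by blast
  qed
  then obtain M where M: "\<And>b y. y \<in> cball x R \<Longrightarrow> norm (dirder g y b) \<le> M b" by metis
  define L where "L = (\<Sum>b\<in>Basis. M b)"
  have M0: "0 \<le> M b" for b using M[of x b] R(1) by (smt (verit) centre_in_cball norm_ge_zero)
  have on: "onorm (dirder g y) \<le> L" if y: "y \<in> cball x R" for y
  proof (rule onorm_bound)
    have lin: "linear (dirder g y)" using smooth_on_linear_dirder[OF assms(2)] y R(2) by blast
    show "norm (dirder g y h) \<le> L * norm h" for h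
    proof -
      have "norm (dirder g y h) = norm (\<Sum>b\<in>Basis. (h \<bullet> b) *\<^sub>R dirder g y b)"
        by (simp add: linear_in_coordinates[OF lin])
      also have "\<dots> \<le> (\<Sum>b\<in>Basis. norm h * M b)"
        by (rule sum_norm_le) (auto intro!: mult_mono M y simp: Basis_le_norm)
      also have "\<dots> = L * norm h" by (simp add: L_def sum_distrib_left mult.commute)
      finally show ?thesis .
    qed
  qed (simp add: L_def sum_nonneg M0)
  have L_lip: "norm (g a - g b) \<le> L * norm (a - b)" if "a \<in> cball x R" "b \<in> cball x R" for a b
    by (rule differentiable_bound[OF convex_cball _ on that])
       (use smooth_on_imp_has_derivative[OF assms(2)] R(2) in \<open>blast intro: has_derivative_at_withinI\<close>)
  have "0 \<le> L" by (simp add: L_def sum_nonneg M0)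
  from that[OF R(1) this R(2) L_lip] show ?thesis by blast
qed

text \<open>Gronwall's lemma for a function that need not be differentiable: an upper bound on its forward difference
quotients suffices. The function is compared with \<open>\<zeta> exp ((K + 1) s)\<close>, which grows strictly faster than
the bound allows, at the last time up to which the comparison holds.\<close>

lemma dini_gronwall:
  fixes \<delta> :: "real \<Rightarrow> real"
  assumes cont: "continuous_on {0..e} \<delta>" and "\<delta> 0 \<le> 0" and "0 \<le> K"
    and step: "\<And>s \<eta>. 0 \<le> s \<Longrightarrow> s < e \<Longrightarrow> 0 < \<eta> \<Longrightarrow>
                 \<forall>\<^sub>F h in at_right 0. \<delta> (s + h) \<le> \<delta> s + h * (K * \<delta> s + \<eta>)"
    and s1: "s1 \<in> {0..e}"
  shows "\<delta> s1 \<le> 0"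
proof -
  have below: "\<delta> s1 \<le> \<zeta> * exp ((K + 1) * s1)" if \<zeta>: "0 < \<zeta>" for \<zeta>
  proof (rule ccontr)
    assume big: "\<not> ?thesis"
    define m where "m s = \<zeta> * exp ((K + 1) * s)" for s
    let ?A = "{s \<in> {0..s1}. \<delta> s \<le> m s}"
    have "closed ?A"
      unfolding m_def using s1
      by (intro continuous_on_closed_Collect_le closed_atLeastAtMost continuous_intros
          continuous_on_subset[OF cont]) auto
    moreover have "bdd_above ?A" by (rule bdd_aboveI[of _ s1]) auto
    moreover have "0 \<in> ?A" using \<zeta> \<open>\<delta> 0 \<le> 0\<close> s1 by (auto simp: m_def)
    ultimately have SA: "Sup ?A \<in> ?A" by (intro closed_contains_Sup) auto
    define s where "s = Sup ?A"
    have s: "0 \<le> s" "s \<le> s1" "\<delta> s \<le> m s" using SA by (auto simp: s_def)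
    then have "s < s1" using big by (cases "s = s1") (auto simp: m_def)
    \<comment> \<open>Slack \<open>\<zeta>\<close> in the difference quotient is absorbed by the extra 1 in the exponent, as \<open>\<zeta> \<le> m s\<close>.\<close>
    have "\<forall>\<^sub>F h in at_right 0. \<delta> (s + h) \<le> \<delta> s + h * (K * \<delta> s + \<zeta>) \<and> h \<in> {0<..<s1 - s}"
      using \<open>s < s1\<close> s s1 by (intro eventually_conj step \<zeta> eventually_at_right_real) auto
    then obtain h where h: "\<delta> (s + h) \<le> \<delta> s + h * (K * \<delta> s + \<zeta>)" "0 < h" "h < s1 - s"
      using eventually_happens by fastforce
    have "\<zeta> \<le> m s" using \<zeta> s(1) \<open>0 \<le> K\<close> by (simp add: m_def)
    have "\<delta> (s + h) \<le> m s + h * (K * m s + m s)"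
      using h(1) s(3) \<open>\<zeta> \<le> m s\<close> h(2) \<open>0 \<le> K\<close>
      by (smt (verit) mult_left_mono)
    also have "\<dots> = m s * (1 + (K + 1) * h)" by (simp add: algebra_simps)
    also have "\<dots> \<le> m s * exp ((K + 1) * h)"
      using \<zeta> by (intro mult_left_mono exp_ge_add_one_self) (simp add: m_def)
    also have "\<dots> = m (s + h)" by (simp add: m_def algebra_simps flip: exp_add)
    finally have "s + h \<in> ?A" using h s by auto
    then have "s + h \<le> s" unfolding s_def by (rule cSup_upper) (rule bdd_aboveI[of _ s1], auto)
    then show False using h(2) by simp
  qed
  show ?thesis
  proof (rule ccontr)
    assume "\<not> \<delta> s1 \<le> 0"
    then show False
      using below[of "\<delta> s1 / (2 * exp ((K + 1) * s1))"] by simp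
  qed
qed

text \<open>A solution of \<open>y' = g y\<close> that starts in \<open>K\<close> stays there for a short time if \<open>g\<close> does not point outward
along any proximal normal \<open>\<nu>\<close> of \<open>K\<close>. If \<open>z\<close> is a nearest point of \<open>K\<close> to \<open>y s\<close>, then \<open>\<nu> = y s - z\<close> is
such a normal, and the squared distance grows at most at the rate
\<open>2 \<nu> \<bullet> g (y s) \<le> 2 \<nu> \<bullet> (g (y s) - g z) \<le> 2 L \<bar>\<nu>\<bar>\<^sup>2\<close>.\<close>

lemma bony_brezis:
  fixes K S :: "'e::euclidean_space set" and y :: "real \<Rightarrow> 'e"
  assumes K: "closed K" and S: "open S" and g: "smooth_on S g" and x: "y 0 \<in> K" "y 0 \<in> S"
    and b: "0 < b" and y: "\<And>s. 0 \<le> s \<Longrightarrow> s \<le> b \<Longrightarrow> (y has_vector_derivative g (y s)) (at s)"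
    and normal: "\<And>z \<nu> N. z \<in> K \<Longrightarrow> z \<in> S \<Longrightarrow> open N \<Longrightarrow> z \<in> N \<Longrightarrow>
        (\<And>w. w \<in> K \<Longrightarrow> w \<in> N \<Longrightarrow> norm \<nu> \<le> norm (z + \<nu> - w)) \<Longrightarrow> \<nu> \<bullet> g z \<le> 0"
  shows "\<exists>e>0. \<forall>s\<in>{0..e}. y s \<in> K"
proof -
  let ?x = "y 0"
  obtain R L where R: "0 < R" "0 \<le> L" "cball ?x R \<subseteq> S"
    and lip: "\<And>a b. a \<in> cball ?x R \<Longrightarrow> b \<in> cball ?x R \<Longrightarrow> norm (g a - g b) \<le> L * norm (a - b)"
    using smooth_locally_lipschitz[OF S g x(2)] by metis
  have cont_y: "continuous_on {0..b} y"
    using y by (intro continuous_at_imp_continuous_on ballI) (auto intro: has_vector_derivative_continuous)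
  then obtain d where d: "d > 0" "\<And>s. s \<in> {0..b} \<Longrightarrow> dist s 0 < d \<Longrightarrow> dist (y s) ?x < R / 2"
    using b R(1) unfolding continuous_on_iff by (metis atLeastAtMost_iff half_gt_zero less_eq_real_def order_refl)
  \<comment> \<open>Up to time e the solution stays so close to its start that nearest points in K lie in the interior of the ball.\<close>
  define e where "e = min b (d / 2)"
  have e: "0 < e" "e \<le> b" using b d by (auto simp: e_def)
  have near: "dist (y s) ?x < R / 2" if "s \<in> {0..e}" for s
    using that d by (intro d(2)) (auto simp: e_def dist_real_def)
  let ?C = "K \<inter> cball ?x R"
  have C: "closed ?C" "?x \<in> ?C" using K x R by auto
  define \<delta> where "\<delta> s = (infdist (y s) ?C)\<^sup>2" for s
  have "\<delta> s \<le> 0" if "s \<in> {0..e}" for s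
  proof (rule dini_gronwall[OF _ _ _ _ that])
    show "continuous_on {0..e} \<delta>"
      unfolding \<delta>_def by (intro continuous_intros continuous_on_subset[OF cont_y]) (use e in auto)
    show "\<delta> 0 \<le> 0" using C by (simp add: \<delta>_def)
    show "0 \<le> 2 * L" using R by simp
    fix s \<eta> :: real assume s: "0 \<le> s" "s < e" and \<eta>: "0 < \<eta>"
    define z where "z = closest_point ?C (y s)"
    have z: "z \<in> ?C" "\<And>w. w \<in> ?C \<Longrightarrow> dist (y s) z \<le> dist (y s) w"
      unfolding z_def using closest_point_exists[OF C(1)] C(2) by blast+
    have ys: "dist (y s) ?x < R / 2" using s by (intro near) auto
    have "dist (y s) z < R / 2" using z(2)[OF C(2)] ys by simp
    then have zb: "z \<in> ball ?x R" using ys dist_triangle[of ?x z "y s"] by (simp add: dist_commute)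
    define \<nu> where "\<nu> = y s - z"
    have "\<nu> \<bullet> g z \<le> 0"
    proof (rule normal[of z "ball ?x R"])
      show "norm \<nu> \<le> norm (z + \<nu> - w)" if "w \<in> K" "w \<in> ball ?x R" for w
        using z(2)[of w] that by (simp add: \<nu>_def dist_norm)
    qed (use z zb R in auto)
    moreover have "\<nu> \<bullet> (g (y s) - g z) \<le> norm \<nu> * (L * norm \<nu>)"
    proof -
      have "\<nu> \<bullet> (g (y s) - g z) \<le> norm \<nu> * norm (g (y s) - g z)" by (rule norm_cauchy_schwarz)
      also have "norm (g (y s) - g z) \<le> L * norm \<nu>"
        unfolding \<nu>_def by (rule lip) (use ys zb R in \<open>auto simp: dist_commute\<close>)
      finally show ?thesis by (simp add: mult_left_mono)
    qed
    ultimately have slope: "2 * (\<nu> \<bullet> g (y s)) \<le> 2 * L * (norm \<nu>)\<^sup>2"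
      by (simp add: inner_diff_right power2_eq_square algebra_simps)
    have inf_eq: "\<delta> s = (norm \<nu>)\<^sup>2"
    proof -
      have "infdist (y s) ?C = dist (y s) z"
        using z infdist_le[OF z(1), of "y s"] C(2)
        by (intro antisym) (auto simp: infdist_def intro!: cINF_greatest)
      then show ?thesis by (simp add: \<delta>_def \<nu>_def dist_norm)
    qed
    define \<phi> where "\<phi> h = (norm (y (s + h) - z))\<^sup>2" for h
    have "((\<lambda>h. y (s + h)) has_vector_derivative g (y s)) (at 0)"
    proof -
      have "((\<lambda>h. s + h) has_vector_derivative 1) (at 0)" by (auto intro!: derivative_eq_intros)
      from vector_diff_chain_at[OF this, of y "g (y s)"] y[of s] s e show ?thesis by (simp add: o_def)
    qed
    then have "((\<lambda>h. y (s + h)) has_derivative (\<lambda>h. h *\<^sub>R g (y s))) (at 0)"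
      by (simp add: has_vector_derivative_def)
    then have "((\<lambda>h. (y (s + h) - z) \<bullet> (y (s + h) - z)) has_derivative
        (\<lambda>h. (y (s + 0) - z) \<bullet> (h *\<^sub>R g (y s) - 0) + (h *\<^sub>R g (y s) - 0) \<bullet> (y (s + 0) - z))) (at 0)"
      by (intro has_derivative_inner has_derivative_diff has_derivative_const)
    then have "(\<phi> has_vector_derivative 2 * (\<nu> \<bullet> g (y s))) (at 0)"
      unfolding has_vector_derivative_def \<phi>_def power2_norm_eq_inner \<nu>_def
      by (simp add: inner_commute algebra_simps)
    from tendsto_difference_quotient[OF has_vector_derivative_at_within[OF this]]
    have "((\<lambda>h. (1 / h) *\<^sub>R (\<phi> h - \<phi> 0)) \<longlongrightarrow> 2 * (\<nu> \<bullet> g (y s))) (at_right 0)" .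
    then have "\<forall>\<^sub>F h in at_right 0. (1 / h) *\<^sub>R (\<phi> h - \<phi> 0) < 2 * (\<nu> \<bullet> g (y s)) + \<eta>"
      using \<eta> by (intro order_tendstoD(2)) auto
    then show "\<forall>\<^sub>F h in at_right 0. \<delta> (s + h) \<le> \<delta> s + h * (2 * L * \<delta> s + \<eta>)"
      using eventually_at_right_less[of 0]
    proof eventually_elim
      case (elim h)
      have "\<delta> (s + h) \<le> \<phi> h"
        unfolding \<delta>_def \<phi>_def using infdist_le[OF z(1), of "y (s + h)"] infdist_nonneg
        by (intro power_mono) (auto simp: dist_norm)
      also have "\<phi> h \<le> \<phi> 0 + h * (2 * (\<nu> \<bullet> g (y s)) + \<eta>)"
        using elim by (simp add: field_simps)
      also have "\<phi> 0 = \<delta> s" by (simp add: \<phi>_def inf_eq \<nu>_def)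
      also have "h * (2 * (\<nu> \<bullet> g (y s)) + \<eta>) \<le> h * (2 * L * \<delta> s + \<eta>)"
        using slope elim(2) by (intro mult_left_mono) (auto simp: inf_eq)
      finally show ?case by simp
    qed
  qed
  then have "infdist (y s) ?C = 0" if "s \<in> {0..e}" for s
    using that by (auto simp: \<delta>_def)
  then have "y s \<in> ?C" if "s \<in> {0..e}" for s
    using that in_closed_iff_infdist_zero[OF C(1)] C(2) by blast
  then show ?thesis using e(1) by blast
qed

context flow_system
begin

text \<open>The place where ampleness enters: the hull of the control vectors is a linear space, so it contains the
negatives of all control vectors, while a half-space that contains the control vectors contains
their hull.\<close>

lemma neg_velocity_in_hull:
  assumes "u \<in> U" and hull: "convex hull (control_vectors U V q) = control_span U V q"
    and half: "\<And>u. u \<in> U \<Longrightarrow> \<nu> \<bullet> V u q c \<le> 0"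
  shows "0 \<le> \<nu> \<bullet> V u q c"
proof -
  let ?H = "{w. \<nu> \<bullet> w c \<le> 0}"
  have "convex ?H"
  proof (rule convexI)
    fix w w' :: "('a, 'e) tvec" and a b :: real
    assume "w \<in> ?H" "w' \<in> ?H" "0 \<le> a" "0 \<le> b"
    then show "a *\<^sub>R w + b *\<^sub>R w' \<in> ?H"
      by (simp add: scaleR_fun_def inner_add_right mult_nonneg_nonpos add_nonpos_nonpos)
  qed
  moreover have "control_vectors U V q \<subseteq> ?H"
    using half by (auto simp: control_vectors_def)
  ultimately have "convex hull (control_vectors U V q) \<subseteq> ?H" by (rule hull_minimal[rotated])
  moreover have "- V u q \<in> control_span U V q"
    unfolding control_span_def using \<open>u \<in> U\<close>
    by (intro span_neg span_base) (auto simp: control_vectors_def)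
  ultimately have "- V u q \<in> ?H" using hull by blast
  then show ?thesis by simp
qed

lemma chart_flow_start_derivative:
  assumes c: "c \<in> \<A>" and u: "u \<in> U" and z: "z \<in> chart_img c"
  shows "((\<lambda>h. chart_flow c u (h, z)) has_vector_derivative local_rep (V u) c z) (at 0)"
  using flow_chart_derivative[OF c u, of 0 "chart_inv c z"] z chart_inv_in[OF atlas c z] snd_chart_inv[OF atlas c z]
  by (simp add: flow_zero u chart_flow_def)

text \<open>Following a flow from \<open>z\<close> into the set does not bring the point closer to \<open>z + \<nu>\<close> than \<open>z\<close> itself; the
derivative of the squared distance at time \<open>0\<close> is therefore nonnegative.\<close>

lemma proximal_normal_forward:
  assumes c: "c \<in> \<A>" and u: "u \<in> U" and z: "z \<in> chart_img c"
    and N: "open N" "z \<in> N"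
    and nearest: "\<And>h. 0 \<le> h \<Longrightarrow> chart_flow c u (h, z) \<in> N \<Longrightarrow> (h, z) \<in> flow_dom c u
        \<Longrightarrow> norm \<nu> \<le> norm (z + \<nu> - chart_flow c u (h, z))"
  shows "\<nu> \<bullet> local_rep (V u) c z \<le> 0"
proof -
  interpret local_flows "chart_img c" U "\<lambda>u. local_rep (V u) c" "flow_dom c" "chart_flow c"
    by (rule local_flows_chart[OF c])
  define w where "w h = chart_flow c u (h, z)" for h
  have w0: "w 0 = z" using psi_zero[OF u z] by (simp add: w_def)
  have dw: "(w has_derivative (\<lambda>h. h *\<^sub>R local_rep (V u) c z)) (at 0)"
    using chart_flow_start_derivative[OF c u z] by (simp add: w_def[abs_def] has_vector_derivative_def)
  define \<phi> where "\<phi> h = (z + \<nu> - w h) \<bullet> (z + \<nu> - w h)" for h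
  have "(\<phi> has_derivative (\<lambda>h. (z + \<nu> - w 0) \<bullet> (0 - h *\<^sub>R local_rep (V u) c z)
            + (0 - h *\<^sub>R local_rep (V u) c z) \<bullet> (z + \<nu> - w 0))) (at 0)"
    unfolding \<phi>_def[abs_def] by (intro has_derivative_inner has_derivative_diff has_derivative_const dw)
  then have "(\<phi> has_vector_derivative - 2 * (\<nu> \<bullet> local_rep (V u) c z)) (at 0)"
    unfolding has_vector_derivative_def by (simp add: w0 inner_commute algebra_simps)
  from tendsto_difference_quotient[OF has_vector_derivative_at_within[OF this]]
  have lim: "((\<lambda>h. (1 / h) *\<^sub>R (\<phi> h - \<phi> 0)) \<longlongrightarrow> - 2 * (\<nu> \<bullet> local_rep (V u) c z)) (at_right 0)" .
  have "isCont w 0" using dw has_derivative_continuous by blast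
  then have "\<forall>\<^sub>F h in at 0. w h \<in> N"
    using N w0 by (simp add: isCont_def topological_tendstoD)
  then have "\<forall>\<^sub>F h in at_right 0. w h \<in> N" by (simp add: eventually_at_split)
  moreover have "\<forall>\<^sub>F h in nhds 0. h \<in> {h. (h, z) \<in> flow_dom c u}"
    by (rule eventually_nhds_in_open[OF open_W_slice(2)[OF u]]) (use W_zero[OF u z] in simp)
  then have "\<forall>\<^sub>F h in at_right 0. (h, z) \<in> flow_dom c u"
    by (simp add: eventually_at_filter eventually_mono)
  ultimately have "\<forall>\<^sub>F h in at_right 0. 0 \<le> (1 / h) *\<^sub>R (\<phi> h - \<phi> 0)"
    using eventually_at_right_less[of 0]
  proof eventually_elim
    case (elim h)
    then have "norm \<nu> \<le> norm (z + \<nu> - w h)" using nearest[of h] by (simp add: w_def)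
    then have "\<phi> 0 \<le> \<phi> h" by (simp add: \<phi>_def w0 norm_le)
    then show ?case using elim by simp
  qed
  from tendsto_lowerbound[OF lim this] show ?thesis by simp
qed

lemma backward_invariant_locally:
  assumes hull: "\<And>q. convex hull (control_vectors U V q) = control_span U V q"
    and S: "closed S" and inv: "\<And>u t p. u \<in> U \<Longrightarrow> p \<in> S \<Longrightarrow> 0 \<le> t \<Longrightarrow> P u t p \<in> S"
    and u: "u \<in> U" and q: "q \<in> S"
  shows "\<exists>e>0. \<forall>s\<in>{0..e}. P u (- s) q \<in> S"
proof -
  obtain c where c: "c \<in> \<A>" "q \<in> fst c" by (rule chart_at)
  interpret local_flows "chart_img c" U "\<lambda>u. local_rep (V u) c" "flow_dom c" "chart_flow c"
    by (rule local_flows_chart[OF c(1)])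
  let ?x = "snd c q"
  have x: "?x \<in> chart_img c" using snd_in_img[OF atlas c] .
  let ?C = "chart_img c \<inter> chart_inv c -` S"
  have "closedin (top_of_set (chart_img c)) ?C"
    by (rule continuous_closedin_preimage[OF continuous_on_chart_inv[OF atlas c(1)] S])
  then obtain K where K: "closed K" "?C = chart_img c \<inter> K" unfolding closedin_closed by blast
  have "open ((\<lambda>s. (- s, ?x)) -` flow_dom c u)"
    by (intro open_vimage open_W u continuous_intros)
  moreover have "0 \<in> (\<lambda>s. (- s, ?x)) -` flow_dom c u" using W_zero[OF u x] by simp
  ultimately obtain b where b: "0 < b" "cball 0 b \<subseteq> (\<lambda>s. (- s, ?x)) -` flow_dom c u"
    using open_contains_cball by blast
  have dom: "(- s, ?x) \<in> flow_dom c u" if "0 \<le> s" "s \<le> b" for s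
    using b(2) that by (auto simp: subset_iff)
  define y where "y s = chart_flow c u (- s, ?x)" for s
  have y0: "y 0 = ?x" using psi_zero[OF u x] by (simp add: y_def)
  have "\<exists>e>0. \<forall>s\<in>{0..e}. y s \<in> K"
  proof (rule bony_brezis[where g="\<lambda>x. - local_rep (V u) c x", OF K(1) open_S])
    have "smooth_on (chart_img c) (\<lambda>x. (- 1) *\<^sub>R local_rep (V u) c x)"
      by (rule smooth_on_scaleR[OF open_S smooth_f[OF u]])
    then show "smooth_on (chart_img c) (\<lambda>x. - local_rep (V u) c x)" by simp
    have "?x \<in> ?C" using x q chart_inv_snd[OF atlas c] by simp
    then show "y 0 \<in> K" "y 0 \<in> chart_img c" using K(2) y0 by auto
    show "0 < b" by (rule b(1))
    show "(y has_vector_derivative - local_rep (V u) c (y s)) (at s)" if "0 \<le> s" "s \<le> b" for s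
    proof -
      have "((\<lambda>t. chart_flow c u (t, ?x)) has_vector_derivative local_rep (V u) c (y s)) (at (- s))"
        using orbit_derivative[OF u dom[OF that]] by (simp add: has_vector_derivative_def y_def)
      moreover have "(uminus has_vector_derivative (- 1::real)) (at s)"
        by (auto intro!: derivative_eq_intros)
      ultimately show ?thesis
        using vector_diff_chain_at[of uminus "- 1" s "\<lambda>t. chart_flow c u (t, ?x)"]
        by (simp add: o_def y_def[abs_def])
    qed
    fix z \<nu> N
    assume z: "z \<in> K" "z \<in> chart_img c" and N: "open N" "z \<in> N"
      and nearest: "\<And>w. w \<in> K \<Longrightarrow> w \<in> N \<Longrightarrow> norm \<nu> \<le> norm (z + \<nu> - w)"
    have zS: "chart_inv c z \<in> S" using z K(2) by blast
    have "\<nu> \<bullet> V u' (chart_inv c z) c \<le> 0" if u': "u' \<in> U" for u'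
    proof -
      have "\<nu> \<bullet> local_rep (V u') c z \<le> 0"
      proof (rule proximal_normal_forward[OF c(1) u' z(2) N])
        fix h :: real assume h: "0 \<le> h" "chart_flow c u' (h, z) \<in> N" "(h, z) \<in> flow_dom c u'"
        have "chart_flow c u' (h, z) \<in> ?C"
          using h(3) inv[OF u' zS h(1)] chart_inv_snd[OF atlas c(1)] snd_in_img[OF atlas c(1)]
          by (simp add: flow_dom_def chart_flow_def)
        then have "chart_flow c u' (h, z) \<in> K" using K(2) by blast
        then show "norm \<nu> \<le> norm (z + \<nu> - chart_flow c u' (h, z))" using nearest h(2) by blast
      qed
      then show ?thesis by (simp add: local_rep_def)
    qed
    from neg_velocity_in_hull[OF u hull this]
    show "\<nu> \<bullet> - local_rep (V u) c z \<le> 0" by (simp add: local_rep_def)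
  qed
  then obtain e where e: "0 < e" "\<And>s. s \<in> {0..e} \<Longrightarrow> y s \<in> K" by blast
  have "P u (- s) q \<in> S" if s: "s \<in> {0..min e b}" for s
  proof -
    have W: "(- s, ?x) \<in> flow_dom c u" using s by (intro dom) auto
    then have "y s \<in> ?C" using e(2)[of s] s W_into[OF u W] K(2) by (simp add: y_def)
    then show ?thesis
      using W chart_inv_snd[OF atlas c(1)] chart_inv_snd[OF atlas c]
      by (simp add: y_def chart_flow_def flow_dom_def)
  qed
  then show ?thesis using e(1) b(1) by (intro exI[of _ "min e b"]) auto
qed

text \<open>The first time at which a reversed flow line would leave \<open>S\<close> contradicts the local statement.\<close>

lemma backward_invariant:
  assumes hull: "\<And>q. convex hull (control_vectors U V q) = control_span U V q"
    and S: "closed S" and inv: "\<And>u t p. u \<in> U \<Longrightarrow> p \<in> S \<Longrightarrow> 0 \<le> t \<Longrightarrow> P u t p \<in> S"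
    and u: "u \<in> U" and q: "q \<in> S"
  shows "P u t q \<in> S"
proof (cases "0 \<le> t")
  case True
  then show ?thesis using inv u q by blast
next
  case False
  show ?thesis
  proof (rule ccontr)
    assume nin: "P u t q \<notin> S"
    let ?B = "{s \<in> {0..}. P u (- s) q \<notin> S}"
    have ne: "- t \<in> ?B" using False nin by simp
    then have nonempty: "?B \<noteq> {}" by blast
    have bdd: "bdd_below ?B" by (rule bdd_belowI[of _ 0]) auto
    define s where "s = Inf ?B"
    have s0: "0 \<le> s" unfolding s_def using cInf_greatest[OF nonempty, of 0] by auto
    have before: "P u (- r) q \<in> S" if "0 \<le> r" "r < s" for r
      using that cInf_lower[OF _ bdd, of r] unfolding s_def by force
    have "P u (- s) q \<in> S"
    proof (rule ccontr)
      assume n: "P u (- s) q \<notin> S"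
      then have "s \<noteq> 0" using q flow_zero[OF u] by auto
      have "open ((\<lambda>r. P u (- r) q) -` (- S))"
        using S by (intro open_vimage continuous_intros u) auto
      then obtain d where d: "0 < d" "ball s d \<subseteq> (\<lambda>r. P u (- r) q) -` (- S)"
        using n openE[of _ s] by (metis ComplI vimageI)
      define r where "r = max 0 (s - d / 2)"
      have "r \<in> ball s d" "0 \<le> r" "r < s"
        using d(1) s0 \<open>s \<noteq> 0\<close> by (auto simp: r_def dist_real_def)
      then show False using d(2) before[of r] by blast
    qed
    then obtain e where e: "0 < e" "\<And>r. r \<in> {0..e} \<Longrightarrow> P u (- r) (P u (- s) q) \<in> S"
      using backward_invariant_locally[OF hull S inv u] by blast
    have "s + e \<le> r" if r: "r \<in> ?B" for r
    proof (rule ccontr)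
      assume "\<not> s + e \<le> r"
      moreover have "s \<le> r" unfolding s_def by (rule cInf_lower[OF r bdd])
      ultimately have "P u (- (r - s)) (P u (- s) q) \<in> S" by (intro e(2)) auto
      then show False using r by (simp add: flow_add[OF u])
    qed
    then have "s + e \<le> s" unfolding s_def using cInf_greatest[OF nonempty] by blast
    then show False using e(1) by simp
  qed
qed

end

section \<open>Reachability of every point\<close>

context flow_system
begin

inductive reach :: "'a \<Rightarrow> 'a \<Rightarrow> bool" for p where
  refl: "reach p p"
| step: "reach p q \<Longrightarrow> u \<in> U \<Longrightarrow> 0 \<le> t \<Longrightarrow> reach p (P u t q)"

lemma reach_flow: "u \<in> U \<Longrightarrow> 0 \<le> t \<Longrightarrow> reach p (P u t p)"
  by (rule reach.step[OF reach.refl])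

lemma reach_trans: "reach q r \<Longrightarrow> reach p q \<Longrightarrow> reach p r"
  by (induction rule: reach.induct) (auto intro: reach.step)

lemma reach_invariant:
  assumes "reach p q" "p \<in> S" "\<And>u t p. u \<in> U \<Longrightarrow> p \<in> S \<Longrightarrow> 0 \<le> t \<Longrightarrow> P u t p \<in> S"
  shows "q \<in> S"
  using assms(1) by (induction rule: reach.induct) (auto intro: assms)

lemma reach_pull_interior:
  assumes "reach p q" "q \<in> interior S"
    and inv: "\<And>u t p. u \<in> U \<Longrightarrow> p \<in> S \<Longrightarrow> P u t p \<in> S"
  shows "p \<in> interior S"
  using assms(1,2)
proof (induction rule: reach.induct)
  case refl
  then show ?case .
next
  case (step q u t)
  have "P u t -` interior S \<subseteq> S"
  proof
    fix z assume "z \<in> P u t -` interior S"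
    then have "P u t z \<in> S" using interior_subset by blast
    from inv[OF step.hyps(2) this, of "- t"] show "z \<in> S"
      by (simp add: flow_add[OF step.hyps(2)] flow_zero[OF step.hyps(2)])
  qed
  then have "P u t -` interior S \<subseteq> interior S"
    by (rule interior_maximal) (rule open_flow_preimage[OF step.hyps(2) open_interior])
  then show ?case using step.IH step.prems by blast
qed

lemma closure_reach_invariant:
  assumes u: "u \<in> U" and t: "0 \<le> t" and q: "q \<in> closure {q. reach p q}"
  shows "P u t q \<in> closure {q. reach p q}"
proof -
  have "P u t ` closure {q. reach p q} \<subseteq> closure {q. reach p q}"
  proof (rule image_closure_subset)
    show "continuous_on (closure {q. reach p q}) (P u t)" by (intro continuous_intros u)
    show "P u t ` {q. reach p q} \<subseteq> closure {q. reach p q}"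
      using closure_subset[of "{q. reach p q}"] reach.step[OF _ u t] by blast
  qed simp
  then show ?thesis using q by blast
qed

text \<open>From every point \<open>q\<close> of the closure some interior point of the closure is reachable, by Krener's theorem for the
set reachable from \<open>q\<close>. As the closure is preserved by all the homeomorphisms \<open>P u t\<close>, the point \<open>q\<close> is an interior
point as well, so that the closure is open.\<close>

lemma reach_dense:
  assumes conn: "connected (UNIV :: 'a set)"
    and hull: "\<And>q. convex hull (control_vectors U V q) = control_span U V q"
    and L: "\<And>q. LARC_at \<A> U V q"
  shows "closure {q. reach p q} = UNIV"
proof -
  let ?S = "closure {q. reach p q}"
  have inv: "P u t q \<in> ?S" if "u \<in> U" "q \<in> ?S" for u t q
    by (rule backward_invariant[OF hull closed_closure closure_reach_invariant that])
  have "q \<in> interior ?S" if q: "q \<in> ?S" for q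
  proof -
    have "interior {r. reach q r} \<noteq> {}"
    proof (rule krener_manifold[OF L, of 1])
      show "q \<in> {r. reach q r}" by (simp add: reach.refl)
    qed (auto intro: reach.step)
    then obtain r where r: "r \<in> interior {r. reach q r}" by blast
    have sub: "{r. reach q r} \<subseteq> ?S"
      using reach_invariant[OF _ q inv] by blast
    have "reach q r" using r interior_subset by blast
    moreover have "r \<in> interior ?S" using r interior_mono[OF sub] by blast
    ultimately show ?thesis by (rule reach_pull_interior) (rule inv)
  qed
  then have "interior ?S = ?S" using interior_subset by blast
  then have "open ?S" using open_interior[of ?S] by simp
  moreover have "p \<in> ?S" using reach.refl closure_subset by blast
  ultimately show ?thesis
    using conn closed_closure[of "{q. reach p q}"] unfolding connected_clopen by auto
qed

text \<open>Krener's theorem in reversed time applies to the set of points from which \<open>q\<close> is reachable.\<close>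

lemma reach_everywhere:
  assumes conn: "connected (UNIV :: 'a set)"
    and hull: "\<And>q. convex hull (control_vectors U V q) = control_span U V q"
    and L: "\<And>q. LARC_at \<A> U V q"
  shows "reach p q"
proof -
  have "interior {r. reach r q} \<noteq> {}"
  proof (rule krener_manifold[OF L, of "- 1"])
    show "q \<in> {r. reach r q}" by (simp add: reach.refl)
    fix u t r assume u: "u \<in> U" and r: "r \<in> {r. reach r q}" and t: "0 < (- 1) * (t::real)"
    have "reach (P u t r) (P u (- t) (P u t r))" using u t by (intro reach_flow) auto
    then have "reach (P u t r) r" by (simp add: flow_add[OF u] flow_zero[OF u])
    then show "P u t r \<in> {r. reach r q}" using r reach_trans by blast
  qed simp
  then have "interior {r. reach r q} \<inter> {r. reach p r} \<noteq> {}"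
    using reach_dense[OF assms, of p] open_Int_closure_eq_empty[OF open_interior] by blast
  then obtain r where "reach p r" "r \<in> interior {r. reach r q}" by blast
  then have "reach r q" using interior_subset by blast
  then show ?thesis using \<open>reach p r\<close> by (rule reach_trans)
qed

end

section \<open>Trajectories with piecewise constant controls\<close>

lemma lipschitz_absolutely_continuous:
  assumes "L-lipschitz_on {a..b} f"
  shows "absolutely_continuous_curve a b f"
  unfolding absolutely_continuous_curve_def
proof (intro allI impI)
  fix \<epsilon> :: real assume \<epsilon>: "0 < \<epsilon>"
  have L: "0 \<le> L" using assms by (rule lipschitz_on_nonneg)
  show "\<exists>\<delta>>0. \<forall>(m::nat) s t.
      (\<forall>i<m. a \<le> s i \<and> s i \<le> t i \<and> t i \<le> b) \<and>
      (\<forall>i<m. \<forall>j<m. i \<noteq> j \<longrightarrow> {s i<..<t i} \<inter> {s j<..<t j} = {}) \<and>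
      (\<Sum>i<m. t i - s i) < \<delta> \<longrightarrow> (\<Sum>i<m. norm (f (t i) - f (s i))) < \<epsilon>"
  proof (intro exI[of _ "\<epsilon> / (L + 1)"] conjI allI impI)
    show "0 < \<epsilon> / (L + 1)" using \<epsilon> L by simp
    fix m :: nat and s t :: "nat \<Rightarrow> real"
    assume *: "(\<forall>i<m. a \<le> s i \<and> s i \<le> t i \<and> t i \<le> b) \<and>
      (\<forall>i<m. \<forall>j<m. i \<noteq> j \<longrightarrow> {s i<..<t i} \<inter> {s j<..<t j} = {}) \<and> (\<Sum>i<m. t i - s i) < \<epsilon> / (L + 1)"
    have "(\<Sum>i<m. norm (f (t i) - f (s i))) \<le> (\<Sum>i<m. L * (t i - s i))"
    proof (rule sum_mono)
      fix i assume "i \<in> {..<m}"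
      then have i: "a \<le> s i" "s i \<le> t i" "t i \<le> b" using * by auto
      then show "norm (f (t i) - f (s i)) \<le> L * (t i - s i)"
        using lipschitz_onD[OF assms, of "t i" "s i"] by (simp add: dist_norm)
    qed
    also have "\<dots> \<le> (L + 1) * (\<Sum>i<m. t i - s i)"
      unfolding sum_distrib_left[symmetric]
      using * by (intro mult_right_mono sum_nonneg) auto
    also have "\<dots> < \<epsilon>" using * L by (simp add: field_simps)
    finally show "(\<Sum>i<m. norm (f (t i) - f (s i))) < \<epsilon>" .
  qed
qed

lemma piecewise_constant_append:
  assumes "piecewise_constant u"
  shows "piecewise_constant (\<lambda>t. if t < T then u t else v)"
  unfolding piecewise_constant_def
proof
  fix M :: real
  obtain F where F: "finite F"
      "\<forall>a b. - M \<le> a \<and> b \<le> M \<and> {a<..<b} \<inter> F = {} \<longrightarrow> u constant_on {a<..<b}"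
    using assms[unfolded piecewise_constant_def, THEN spec, of M] by (elim exE conjE) (rule that)
  show "\<exists>F. finite F \<and> (\<forall>a b. - M \<le> a \<and> b \<le> M \<and> {a<..<b} \<inter> F = {} \<longrightarrow>
      (\<lambda>t. if t < T then u t else v) constant_on {a<..<b})"
  proof (intro exI[of _ "insert T F"] conjI allI impI)
    fix a b :: real assume ab: "- M \<le> a \<and> b \<le> M \<and> {a<..<b} \<inter> insert T F = {}"
    then have "T \<notin> {a<..<b}" and ab': "- M \<le> a" "b \<le> M" "{a<..<b} \<inter> F = {}" by blast+
    then have T: "T \<le> a \<or> b \<le> T" unfolding greaterThanLessThan_iff by linarith
    have "u constant_on {a<..<b}" by (intro F(2)[rule_format] conjI ab')
    then obtain y where y: "\<And>t. t \<in> {a<..<b} \<Longrightarrow> u t = y" unfolding constant_on_def by blast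
    have "(if t < T then u t else v) = (if T \<le> a then v else y)" if "t \<in> {a<..<b}" for t
      using y[OF that] that T by (cases "T \<le> a") simp_all
    then show "(\<lambda>t. if t < T then u t else v) constant_on {a<..<b}"
      unfolding constant_on_def by (intro exI ballI)
  qed (use F(1) in simp)
qed

context flow_system
begin

text \<open>A trajectory with piecewise constant control in a form that is stable under concatenation: Lipschitz
instead of absolutely continuous, and with two-sided velocities outside a finite set instead of almost
everywhere.\<close>

definition pc_path :: "(real \<Rightarrow> 'u) \<Rightarrow> (real \<Rightarrow> 'a) \<Rightarrow> real \<Rightarrow> bool"
  where "pc_path u \<gamma> T \<longleftrightarrow> 0 \<le> T \<and> u \<in> piecewise_constant_controls U \<and> continuous_on {0..T} \<gamma> \<and>
     (\<forall>c\<in>\<A>. \<forall>a b. 0 \<le> a \<and> a \<le> b \<and> b \<le> T \<and> \<gamma> ` {a..b} \<subseteq> fst c \<longrightarrow>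
        (\<exists>L. L-lipschitz_on {a..b} (snd c \<circ> \<gamma>))) \<and>
     (\<exists>F. finite F \<and> (\<forall>t\<in>{0<..<T} - F. has_velocity \<A> \<gamma> (V (u t) (\<gamma> t)) t UNIV))"

lemma pc_path_trajectory_under:
  assumes "pc_path u \<gamma> T"
  shows "trajectory_under \<A> V u \<gamma> T"
proof -
  obtain F where F: "finite F" "\<forall>t\<in>{0<..<T} - F. has_velocity \<A> \<gamma> (V (u t) (\<gamma> t)) t UNIV"
    using assms unfolding pc_path_def by blast
  have "AE t in lebesgue. t \<notin> F \<union> {0, T}"
    by (rule AE_not_in) (use F(1) in \<open>simp add: countable_imp_null_set_lborel null_sets_completionI countable_finite\<close>)
  then have "AE t in lebesgue. t \<in> {0..T} \<longrightarrow> has_velocity \<A> \<gamma> (V (u t) (\<gamma> t)) t {0..T}"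
  proof eventually_elim
    case (elim t)
    show ?case
    proof
      assume "t \<in> {0..T}"
      then have "has_velocity \<A> \<gamma> (V (u t) (\<gamma> t)) t UNIV" using elim F(2) by auto
      then show "has_velocity \<A> \<gamma> (V (u t) (\<gamma> t)) t {0..T}"
        unfolding has_velocity_def by (blast intro: has_vector_derivative_at_within)
    qed
  qed
  then show ?thesis
    using assms lipschitz_absolutely_continuous unfolding trajectory_under_def pc_path_def by blast
qed

lemma flow_lipschitz:
  assumes c: "c \<in> \<A>" and u: "u \<in> U" and sub: "\<And>t. t \<in> {a..b} \<Longrightarrow> P u t q \<in> fst c"
  shows "\<exists>L. L-lipschitz_on {a..b} (\<lambda>t. snd c (P u t q))"
proof -
  let ?v = "\<lambda>t. local_rep (V u) c (snd c (P u t q))"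
  have "continuous_on {a..b} ?v"
  proof (rule continuous_on_compose2[OF smooth_on_imp_continuous_on[OF smooth_local_rep[OF c u]]])
    show "continuous_on {a..b} (\<lambda>t. snd c (P u t q))"
      by (rule continuous_on_compose2[OF continuous_on_chart[OF atlas c]])
         (use sub in \<open>auto intro!: continuous_intros u\<close>)
  qed (use sub snd_in_img[OF atlas c] in blast)
  then have "bounded (?v ` {a..b})"
    by (intro compact_imp_bounded compact_continuous_image compact_Icc)
  then obtain B where B: "\<And>t. t \<in> {a..b} \<Longrightarrow> norm (?v t) \<le> B" unfolding bounded_iff by blast
  have "\<bar>B\<bar>-lipschitz_on {a..b} (\<lambda>t. snd c (P u t q))"
  proof (rule bounded_derivative_imp_lipschitz)
    show "((\<lambda>t. snd c (P u t q)) has_derivative (\<lambda>h. h *\<^sub>R ?v t)) (at t within {a..b})" if "t \<in> {a..b}" for t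
      using flow_chart_derivative[OF c u sub[OF that]]
      by (auto simp: has_vector_derivative_def intro: has_derivative_at_withinI)
    show "onorm (\<lambda>h. h *\<^sub>R ?v t) \<le> \<bar>B\<bar>" if "t \<in> {a..b}" for t
    proof (rule onorm_bound)
      have "norm (?v t) \<le> \<bar>B\<bar>" using B[OF that] by simp
      then show "norm (h *\<^sub>R ?v t) \<le> \<bar>B\<bar> * norm h" for h :: real
        using mult_right_mono[of "norm (?v t)" "\<bar>B\<bar>" "\<bar>h\<bar>"] by (simp add: mult.commute)
    qed simp
  qed auto
  then show ?thesis by blast
qed

lemma has_velocity_cong:
  assumes "open I" "t \<in> I" "\<And>s. s \<in> I \<Longrightarrow> \<gamma> s = \<gamma>' s"
  shows "has_velocity \<A> \<gamma> v t UNIV \<longleftrightarrow> has_velocity \<A> \<gamma>' v t UNIV"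
proof -
  have "((snd c \<circ> \<gamma>) has_vector_derivative v c) (at t) \<longleftrightarrow> ((snd c \<circ> \<gamma>') has_vector_derivative v c) (at t)" for c :: "('a, 'e) chart"
    unfolding has_vector_derivative_def
    by (rule has_derivative_cong_open[OF assms(1) _ assms(2)]) (simp add: assms(3))
  then show ?thesis unfolding has_velocity_def using assms(2,3) by simp
qed

lemma pc_path_const: "u \<in> U \<Longrightarrow> pc_path (\<lambda>_. u) (\<lambda>_. p) 0"
proof -
  assume u: "u \<in> U"
  have "\<exists>L. L-lipschitz_on {a..b} (snd c \<circ> (\<lambda>_. p))" for a b :: real and c :: "('a, 'e) chart"
    by (intro exI[of _ 0]) (simp add: lipschitz_on_def)
  then show ?thesis using u
    by (auto simp: pc_path_def piecewise_constant_controls_def piecewise_constant_def constant_on_def)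
qed

lemma pc_path_append:
  assumes path: "pc_path u \<gamma> T" and v: "v \<in> U" and \<tau>: "0 \<le> \<tau>"
  shows "pc_path (\<lambda>t. if t < T then u t else v) (\<lambda>t. if t \<le> T then \<gamma> t else P v (t - T) (\<gamma> T)) (T + \<tau>)"
    (is "pc_path ?u ?\<gamma> _")
proof -
  have T: "0 \<le> T" and uc: "u \<in> piecewise_constant_controls U" and cont: "continuous_on {0..T} \<gamma>"
    and lip: "\<And>c a b. c \<in> \<A> \<Longrightarrow> 0 \<le> a \<Longrightarrow> a \<le> b \<Longrightarrow> b \<le> T \<Longrightarrow> \<gamma> ` {a..b} \<subseteq> fst c \<Longrightarrow>
        \<exists>L. L-lipschitz_on {a..b} (snd c \<circ> \<gamma>)"
    using path unfolding pc_path_def by blast+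
  obtain F where F: "finite F" "\<And>t. t \<in> {0<..<T} - F \<Longrightarrow> has_velocity \<A> \<gamma> (V (u t) (\<gamma> t)) t UNIV"
    using path unfolding pc_path_def by blast
  have at_end: "?\<gamma> t = P v (t - T) (\<gamma> T)" if "T \<le> t" for t
    using that by (cases "t = T") (simp_all add: flow_zero[OF v])
  show ?thesis
    unfolding pc_path_def
  proof (intro conjI ballI allI impI)
    show "0 \<le> T + \<tau>" using T \<tau> by simp
    show "?u \<in> piecewise_constant_controls U"
      using uc piecewise_constant_append v unfolding piecewise_constant_controls_def by auto
    have "continuous_on ({0..T} \<union> {T..T + \<tau>}) ?\<gamma>"
    proof (rule continuous_on_closed_Un)
      show "continuous_on {0..T} ?\<gamma>" using cont by (rule continuous_on_eq) auto
      have "continuous_on {T..T + \<tau>} (\<lambda>t. P v (t - T) (\<gamma> T))" by (intro continuous_intros v)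
      then show "continuous_on {T..T + \<tau>} ?\<gamma>" by (rule continuous_on_eq) (auto simp: at_end simp del: if_split)
    qed auto
    then show "continuous_on {0..T + \<tau>} ?\<gamma>" using T \<tau> by (simp add: ivl_disj_un_two_touch)
  next
    fix c a b
    assume c: "c \<in> \<A>" and ab: "0 \<le> a \<and> a \<le> b \<and> b \<le> T + \<tau> \<and> ?\<gamma> ` {a..b} \<subseteq> fst c"
    have before: "\<exists>L. L-lipschitz_on {a..b'} (snd c \<circ> ?\<gamma>)" if b': "a \<le> b'" "b' \<le> b" "b' \<le> T" for b'
    proof -
      have "\<gamma> ` {a..b'} \<subseteq> ?\<gamma> ` {a..b}"
      proof
        fix x assume "x \<in> \<gamma> ` {a..b'}"
        then obtain t where "x = \<gamma> t" "t \<in> {a..b'}" by blast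
        then show "x \<in> ?\<gamma> ` {a..b}" using b' by (intro image_eqI[of _ _ t]) auto
      qed
      then obtain L where "L-lipschitz_on {a..b'} (snd c \<circ> \<gamma>)" using lip[OF c, of a b'] ab b' by blast
      then have "L-lipschitz_on {a..b'} (snd c \<circ> ?\<gamma>)"
        using b' by (simp add: lipschitz_on_def)
      then show ?thesis by blast
    qed
    have after: "\<exists>L. L-lipschitz_on {a'..b} (snd c \<circ> ?\<gamma>)" if a': "a \<le> a'" "T \<le> a'" for a'
    proof -
      have "\<exists>L. L-lipschitz_on {a' - T..b - T} (\<lambda>t. snd c (P v t (\<gamma> T)))"
      proof (rule flow_lipschitz[OF c v])
        fix t assume t: "t \<in> {a' - T..b - T}"
        then have "t + T \<in> {a..b}" using a' by auto
        then have "?\<gamma> (t + T) \<in> fst c" using ab by blast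
        moreover have "?\<gamma> (t + T) = P v (t + T - T) (\<gamma> T)" by (rule at_end) (use t a' in simp)
        ultimately show "P v t (\<gamma> T) \<in> fst c" by (simp only: add_diff_cancel_right')
      qed
      then obtain L where L: "L-lipschitz_on {a' - T..b - T} (\<lambda>t. snd c (P v t (\<gamma> T)))" ..
      have "L-lipschitz_on {a'..b} (snd c \<circ> ?\<gamma>)"
      proof (rule lipschitz_onI)
        fix s t assume st: "s \<in> {a'..b}" "t \<in> {a'..b}"
        then show "dist ((snd c \<circ> ?\<gamma>) s) ((snd c \<circ> ?\<gamma>) t) \<le> L * dist s t"
          using lipschitz_onD[OF L, of "s - T" "t - T"] at_end[of s] at_end[of t] a'
          by (simp add: dist_norm del: if_split)
      qed (rule lipschitz_on_nonneg[OF L])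
      then show ?thesis by blast
    qed
    show "\<exists>L. L-lipschitz_on {a..b} (snd c \<circ> ?\<gamma>)"
    proof (cases "b \<le> T \<or> T \<le> a")
      case True
      then show ?thesis using before[of b] after[of a] ab by blast
    next
      case False
      then obtain L L' where L: "L-lipschitz_on {a..T} (snd c \<circ> ?\<gamma>)" "L'-lipschitz_on {T..b} (snd c \<circ> ?\<gamma>)"
        using before[of T] after[of T] by (meson linear order_refl)
      from lipschitz_on_concat_max[OF L HOL.refl]
      have "(max L L')-lipschitz_on {a..b} (\<lambda>t. if t \<le> T then (snd c \<circ> ?\<gamma>) t else (snd c \<circ> ?\<gamma>) t)" .
      then show ?thesis by auto
    qed
  next
    show "\<exists>F. finite F \<and> (\<forall>t\<in>{0<..<T + \<tau>} - F. has_velocity \<A> ?\<gamma> (V (?u t) (?\<gamma> t)) t UNIV)"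
    proof (intro exI[of _ "insert T F"] conjI ballI)
      fix t assume t: "t \<in> {0<..<T + \<tau>} - insert T F"
      show "has_velocity \<A> ?\<gamma> (V (?u t) (?\<gamma> t)) t UNIV"
      proof (cases "t < T")
        case True
        then have "has_velocity \<A> \<gamma> (V (u t) (\<gamma> t)) t UNIV" using t by (intro F(2)) auto
        then have "has_velocity \<A> ?\<gamma> (V (u t) (\<gamma> t)) t UNIV"
          by (rule iffD1[OF has_velocity_cong[of "{..<T}"], rotated 3]) (use True in auto)
        then show ?thesis using True by simp
      next
        case False
        then have tT: "T < t" using t by auto
        have "has_velocity \<A> (\<lambda>t. P v (t - T) (\<gamma> T)) (V v (P v (t - T) (\<gamma> T))) t UNIV"
          unfolding has_velocity_def
        proof (intro ballI impI)
          fix c assume c: "c \<in> \<A>" "P v (t - T) (\<gamma> T) \<in> fst c"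
          have "((\<lambda>s. s - T) has_vector_derivative 1) (at t)" by (auto intro!: derivative_eq_intros)
          from vector_diff_chain_at[OF this flow_chart_derivative[OF c(1) v c(2)]]
          show "((snd c \<circ> (\<lambda>t. P v (t - T) (\<gamma> T))) has_vector_derivative V v (P v (t - T) (\<gamma> T)) c) (at t)"
            using local_rep_at[OF c, of "V v"] by (simp add: o_def)
        qed
        then have "has_velocity \<A> ?\<gamma> (V v (P v (t - T) (\<gamma> T))) t UNIV"
          by (rule iffD1[OF has_velocity_cong[of "{T<..}"], rotated 3]) (use tT in auto)
        then show ?thesis using tT by simp
      qed
    qed (use F(1) in simp)
  qed
qed

lemma reach_pc_path:
  assumes "U \<noteq> {}" "reach p q"
  shows "\<exists>u \<gamma> T. pc_path u \<gamma> T \<and> \<gamma> 0 = p \<and> \<gamma> T = q"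
  using assms(2)
proof (induction rule: reach.induct)
  case refl
  obtain u where "u \<in> U" using assms(1) by blast
  from pc_path_const[OF this, of p] show ?case by blast
next
  case (step q v \<tau>)
  then obtain u \<gamma> T where *: "pc_path u \<gamma> T" "\<gamma> 0 = p" "\<gamma> T = q" by blast
  have "0 \<le> T" using *(1) by (simp add: pc_path_def)
  let ?\<gamma> = "\<lambda>t. if t \<le> T then \<gamma> t else P v (t - T) (\<gamma> T)"
  have "?\<gamma> 0 = p" "?\<gamma> (T + \<tau>) = P v \<tau> q"
    using *(2,3) \<open>0 \<le> T\<close> step.hyps(3) by (auto simp: flow_zero[OF step.hyps(2)])
  then show ?case using pc_path_append[OF *(1) step.hyps(2,3)] by blast
qed

end

section \<open>Controllability and closed trajectories\<close>

lemma control_system_flow_system: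
  assumes "control_system \<A> U V \<U>"
  obtains P where "flow_system \<A> U V P"
proof -
  have "\<forall>u\<in>U. \<exists>P. generates \<A> (V u) P" using assms by (simp add: control_system_def)
  then obtain P where "\<And>u. u \<in> U \<Longrightarrow> generates \<A> (V u) (P u)" by metis
  then have "flow_system \<A> U V P"
    using assms by unfold_locales (auto simp: control_system_def)
  then show ?thesis by (rule that)
qed

lemma lie_algebra_empty: "X \<in> lie_algebra \<A> {} \<Longrightarrow> X q c = 0"
proof (induction arbitrary: q rule: lie_algebra.induct)
  case (bracket X Y)
  have "local_rep X c = (\<lambda>_. 0)" "local_rep Y c = (\<lambda>_. 0)"
    using bracket.IH by (auto simp: local_rep_def)
  then show ?case by (simp add: lie_bracket_def)
qed (auto simp: scaleR_fun_def)

lemma LARC_nonempty: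
  assumes "smooth_atlas (\<A> :: ('a::topological_space, 'e::euclidean_space) chart set)" "LARC_at \<A> U V q"
  shows "U \<noteq> {}"
proof
  assume "U = {}"
  then have eq: "(\<lambda>X. X q) ` lie_algebra \<A> {} = tangent_space \<A> q"
    using assms(2) by (auto simp: LARC_at_def)
  obtain c where c: "c \<in> \<A>" "q \<in> fst c" using assms(1) unfolding smooth_atlas_def by blast
  obtain v :: 'e where v: "v \<in> Basis" using nonempty_Basis by blast
  obtain w where "w \<in> tangent_space \<A> q" "w c = v"
    by (rule tangent_vector_with_component[OF assms(1) c])
  then obtain X where X: "X \<in> lie_algebra \<A> {}" "w = X q" using eq by blast
  then have "v = 0" using lie_algebra_empty[OF X(1), of q c] \<open>w c = v\<close> by simp
  then show False using v by simp
qed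

theorem mainTheorem2:
  fixes \<A> :: "('a::{t2_space, second_countable_topology}, 'e::euclidean_space) chart set"
    and U :: "'u::topological_space set"
    and V :: "'u \<Rightarrow> ('a, 'e) vfield"
    and \<U> :: "(real \<Rightarrow> 'u) set"
  assumes "compact (UNIV :: 'a set)"
    and "connected (UNIV :: 'a set)"
    and "control_system \<A> U V \<U>"
    and "\<forall>q. ample_at \<A> U V q"
    and "\<forall>q. LARC_at \<A> U V q"
  shows "controllable \<A> V \<U> \<longleftrightarrow>
         (\<forall>q. \<exists>\<gamma> t\<^sub>q. 0 < t\<^sub>q \<and> trajectory \<A> V \<U> \<gamma> t\<^sub>q \<and> \<gamma> 0 = q \<and> \<gamma> t\<^sub>q = q)"
proof -
  obtain P where "flow_system \<A> U V P" using control_system_flow_system[OF assms(3)] .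
  then interpret flow_system \<A> U V P .
  obtain v where v: "v \<in> U" using LARC_nonempty[OF atlas] assms(5) by blast
  have pc: "piecewise_constant_controls U \<subseteq> \<U>" using assms(3) by (simp add: control_system_def)
  have traj: "trajectory \<A> V \<U> \<gamma> T" if "pc_path u \<gamma> T" for u \<gamma> T
    using pc_path_trajectory_under[OF that] that pc unfolding trajectory_def pc_path_def by blast
  have path: "\<exists>u \<gamma> T. pc_path u \<gamma> T \<and> \<gamma> 0 = p \<and> \<gamma> T = q" for p q
  proof (rule reach_pc_path)
    show "reach p q"
      by (rule reach_everywhere[OF assms(2)]) (use assms(4,5) in \<open>auto simp: ample_at_def\<close>)
  qed (use v in blast)
  have "controllable \<A> V \<U>"
    unfolding controllable_def using path traj by meson
  moreover have "\<exists>\<gamma> T. 0 < T \<and> trajectory \<A> V \<U> \<gamma> T \<and> \<gamma> 0 = q \<and> \<gamma> T = q" for q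
  proof -
    obtain u \<gamma> T where \<gamma>: "pc_path u \<gamma> T" "\<gamma> 0 = q" "\<gamma> T = P v (- 1) q" using path by blast
    have T: "0 \<le> T" using \<gamma>(1) by (simp add: pc_path_def)
    let ?\<gamma> = "\<lambda>t. if t \<le> T then \<gamma> t else P v (t - T) (\<gamma> T)"
    have "trajectory \<A> V \<U> ?\<gamma> (T + 1)"
      by (rule traj[OF pc_path_append[OF \<gamma>(1) v]]) simp
    moreover have "?\<gamma> 0 = q" "?\<gamma> (T + 1) = q"
      using T \<gamma>(2,3) by (simp_all add: flow_add[OF v] flow_zero[OF v])
    moreover have "0 < T + 1" using T by simp
    ultimately show ?thesis by blast
  qed
  ultimately show ?thesis by blast
qed

end
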